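(* Let $d\ge0$. The flag-vectors of lattices of flats of $(d+1)$-dimensional zonotopes span the flag-vectors of rank $d+1$ posets; that is, \[ \dim\mathrm{aff}\{\mathbf{W}(\mathcal{L}(Z)):Z\text{ a zonotope of dimension }d+1\}=2^d-1. \]
   Context: A zonotope in $\mathbb{R}^n$ is a polytope $Z$ with $t+Z=\{\sum_{j=1}^k\lambda_jz_j:-1\le\lambda_j\le1\}$ for some $t$ and nonzero $z_j$; here $Z\subset\mathbb{R}^{d+1}$ is full-dimensional. $\mathcal{L}(Z)=\{\mathsf{L}(F):F\text{ nonempty face of }Z\}$, where $\mathsf{L}(F)$ is the linear subspace parallel to the affine hull of $F$, ordered by inclusion; it is a graded poset of rank $d+1$ with rank $=$ dimension, minimum $\{0\}$ and maximum $\mathbb{R}^{d+1}$. For a graded poset $\mathcal{Q}$ of rank $d+1$ with minimum and maximum, and $S=\{s_1<\cdots<s_k\}\subseteq\{1,\dots,d\}$, $W_S(\mathcal{Q})$ is the number of chains $c_1\prec\cdots\prec c_k$ in $\mathcal{Q}$ with $\mathrm{rk}(c_i)=s_i$ (so $W_\emptyset=1$); the flag-vector is $\mathbf{W}(\mathcal{Q})=(W_S(\mathcal{Q}))_{S\subseteq\{1,\dots,d\}}\in\mathbb{R}^{2^d}$. $\mathrm{aff}$ denotes affine hull. *)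

theory Defs
  imports "HOL-Analysis.Analysis"
begin

definition zonotope :: "'a::euclidean_space set \<Rightarrow> bool" where
  "zonotope Z \<longleftrightarrow> polytope Z \<and>
    (\<exists>t (k::nat) z. (\<forall>j\<in>{1..k}. z j \<noteq> 0) \<and>
      (\<lambda>x. t + x) ` Z =
        {(\<Sum>j=1..k. c j *\<^sub>R z j) | c :: nat \<Rightarrow> real. \<forall>j\<in>{1..k}. -1 \<le> c j \<and> c j \<le> 1})"

definition parallel_subspace :: "'a::euclidean_space set \<Rightarrow> 'a set" where
  "parallel_subspace F = (THE L. subspace L \<and> affine_parallel (affine hull F) L)"

definition lattice_of_flats :: "'a::euclidean_space set \<Rightarrow> 'a set set" where
  "lattice_of_flats Z = {parallel_subspace F | F. F face_of Z \<and> F \<noteq> {}}"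

text \<open>A poset is given by its underlying set \<open>Q\<close>, ordered by the order of the type; for
  sets this is inclusion.  The rank of an element is the length (number of elements minus one)
  of a longest chain in \<open>Q\<close> below it; in a graded poset with minimum this is the
  usual rank function.\<close>

definition poset_rank :: "'a::order set \<Rightarrow> 'a \<Rightarrow> nat" where
  "poset_rank Q x =
    Max {n. \<exists>cs. sorted_wrt (<) cs \<and> set cs \<subseteq> {y \<in> Q. y \<le> x} \<and> length cs = Suc n}"

definition flag_number :: "'a::order set \<Rightarrow> nat set \<Rightarrow> nat" where
  "flag_number Q S =
    card {cs. sorted_wrt (<) cs \<and> set cs \<subseteq> Q \<and> map (poset_rank Q) cs = sorted_list_of_set S}"

text \<open>For \<open>CARD('n) = d + 1\<close>, the type \<open>'n rank_set\<close> consists of the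
  \<open>2 ^ d\<close> subsets of \<open>{1..d}\<close>, so that \<open>real ^ 'n rank_set\<close> is the space of flag-vectors
  of posets of rank \<open>d + 1\<close>.\<close>

typedef 'n rank_set = "Pow {1..<CARD('n)}"
  by blast

instance rank_set :: (type) finite
proof
  have "range (Rep_rank_set :: 'a rank_set \<Rightarrow> nat set) \<subseteq> Pow {1..<CARD('a)}"
    using Rep_rank_set by blast
  then have "finite (range (Rep_rank_set :: 'a rank_set \<Rightarrow> nat set))"
    by (rule finite_subset) simp
  then show "finite (UNIV :: 'a rank_set set)"
    by (rule finite_imageD) (simp add: inj_on_def Rep_rank_set_inject)
qed

definition flag_vector :: "'a::order set \<Rightarrow> real ^ 'n rank_set" where
  "flag_vector Q = (\<chi> S. real (flag_number Q (Rep_rank_set S)))"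

end

theory Submission imports Defs begin

text \<open>Since \<open>W\<^bsub>{}\<^esub> = 1\<close>, the affine dimension is at most \<open>2 ^ d - 1\<close>, and equality means that no nonzero
  linear functional \<open>\<alpha>\<close> vanishes on all flag-vectors. The lattice of flats of the zonotope generated by
  a finite spanning set \<open>A\<close> consists of the spans of subsets of \<open>A\<close>, so one may argue with finite sets of
  vectors, also non-spanning ones. Adding a vector that lies in no proper flat of \<open>A\<close> changes the flag
  numbers by a unipotent operator \<open>T = 1 + E\<close>, with
  \<open>(E w)\<^bsub>S\<^esub> = (\<Sum>s\<in>S. w\<^bsub>S'\<^esub>)\<close>, where \<open>S'\<close> arises from \<open>S\<close> by decreasing all elements
  \<open>\<ge> s\<close> by one. As \<open>T\<close> is injective, a functional vanishing on all spanning sets may be replaced by one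
  that vanishes on all finite sets. Evaluating it on sets spanning a hyperplane gives, by induction on the
  dimension, \<open>\<alpha>\<^bsub>S \<union> {d}\<^esub> = - \<alpha>\<^bsub>S\<^esub>\<close>, and likewise for \<open>\<alpha> \<circ> T\<close>. These two relations
  force \<open>\<alpha> = 0\<close>: they imply the same relations for \<open>d - 1\<close>.\<close>

subsection \<open>Flats and flags of a vector configuration\<close>

text \<open>The flats of the linear matroid of \<open>A\<close>, each represented by the subspace it
  spans, so that rank is dimension and the order is inclusion. \<open>A\<close> may be dependent,
  contain zero or fail to span the space.\<close>

definition flats :: "'a::euclidean_space set \<Rightarrow> 'a set set" where
  "flats A = {span B | B. B \<subseteq> A}"

text \<open>Flags are functions on \<open>S\<close> rather than lists, which makes it easy to
  insert, drop or replace a member of given dimension. Weak monotonicity suffices, since different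
  dimensions make the inclusions strict.\<close>

definition flags :: "'a::euclidean_space set \<Rightarrow> nat set \<Rightarrow> (nat \<Rightarrow> 'a set) set" where
  "flags A S = {c \<in> S \<rightarrow>\<^sub>E flats A.
     (\<forall>t\<in>S. dim (c t) = t) \<and> (\<forall>t\<in>S. \<forall>u\<in>S. t \<le> u \<longrightarrow> c t \<subseteq> c u)}"

text \<open>The set \<open>S'\<close> of the overview, except that \<open>0\<close> arises when
  \<open>s = 1\<close>; it has to be removed afterwards. The elements \<open>s - 1\<close> and
  \<open>s\<close> are merged if both are present.\<close>

definition pull_down :: "nat \<Rightarrow> nat set \<Rightarrow> nat set" where
  "pull_down s S = {x \<in> S. x < s} \<union> (\<lambda>x. x - 1) ` {x \<in> S. s \<le> x}"

lemma finite_flats: "finite A \<Longrightarrow> finite (flats A)"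
  by (simp add: flats_def Setcompr_eq_image flip: Pow_def)

lemma subspace_flat: "F \<in> flats A \<Longrightarrow> subspace F"
  by (auto simp: flats_def)

lemma span_flat: "F \<in> flats A \<Longrightarrow> span F = F"
  by (simp add: subspace_flat)

lemma flats_mono: "A \<subseteq> B \<Longrightarrow> flats A \<subseteq> flats B"
  by (auto simp: flats_def)

lemma flat_subset_span: "F \<in> flats A \<Longrightarrow> F \<subseteq> span A"
  by (auto simp: flats_def dest: span_mono)

lemma zero_in_flats: "{0} \<in> flats A"
  by (auto simp: flats_def intro!: exI[of _ "{}"])

lemma span_in_flats: "span A \<in> flats A"
  by (auto simp: flats_def)

lemma span_insert_span: "span (insert p (span B)) = span (insert p B)"
proof (rule antisym)
  show "span (insert p (span B)) \<subseteq> span (insert p B)"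
    by (rule span_minimal) (auto intro: span_base span_mono[THEN subsetD, of B])
  show "span (insert p B) \<subseteq> span (insert p (span B))"
    by (intro span_mono insert_mono span_superset)
qed

lemma span_insert_flat:
  assumes "F \<in> flats A" "a \<in> A"
  shows "span (insert a F) \<in> flats A"
proof -
  obtain B where "B \<subseteq> A" "F = span B" using assms by (auto simp: flats_def)
  then show ?thesis
    using assms(2) by (auto simp: flats_def span_insert_span intro!: exI[of _ "insert a B"])
qed

lemma dim_span_insert_notin:
  assumes "F \<in> flats A" "p \<notin> F"
  shows "dim (span (insert p F)) = dim F + 1"
  using assms by (simp add: dim_insert span_flat)

lemma finite_flags: "finite A \<Longrightarrow> finite S \<Longrightarrow> finite (flags A S)"
  unfolding flags_def by (simp add: finite_PiE finite_flats)

lemma flags_empty [simp]: "flags A {} = {\<lambda>_. undefined}"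
  by (auto simp: flags_def)

text \<open>Each flag on \<open>S\<close> extends in exactly one way, by \<open>X\<close>, so
  restriction to \<open>S\<close> is a bijection. The cases of interest are the least and the
  greatest flat.\<close>

lemma card_flags_insert:
  assumes X: "X \<in> flats A" "dim X = t" "t \<notin> S"
    and uniq: "\<And>F. F \<in> flats A \<Longrightarrow> dim F = t \<Longrightarrow> F = X"
    and below: "\<And>F. F \<in> flats A \<Longrightarrow> dim F \<in> S \<Longrightarrow> dim F \<le> t \<Longrightarrow> F \<subseteq> X"
    and above: "\<And>F. F \<in> flats A \<Longrightarrow> dim F \<in> S \<Longrightarrow> t \<le> dim F \<Longrightarrow> X \<subseteq> F"
  shows "card (flags A (insert t S)) = card (flags A S)"
proof -
  have "bij_betw (\<lambda>c. restrict c S) (flags A (insert t S)) (flags A S)"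
  proof (rule bij_betw_byWitness[where f' = "\<lambda>c. c(t := X)"])
    show "\<forall>c\<in>flags A (insert t S). (restrict c S)(t := X) = c"
    proof
      fix c assume c: "c \<in> flags A (insert t S)"
      then have "c t = X" using uniq by (auto simp: flags_def)
      then show "(restrict c S)(t := X) = c"
        using c by (auto simp: flags_def fun_eq_iff PiE_def extensional_def)
    qed
    show "\<forall>c\<in>flags A S. restrict (c(t := X)) S = c"
      using X(3) by (auto simp: flags_def fun_eq_iff PiE_def extensional_def)
    show "(\<lambda>c. restrict c S) ` flags A (insert t S) \<subseteq> flags A S"
    proof
      fix g assume "g \<in> (\<lambda>c. restrict c S) ` flags A (insert t S)"
      then obtain c where "c \<in> flags A (insert t S)" and g: "g = restrict c S" by blast
      then have "\<And>u. u \<in> S \<Longrightarrow> c u \<in> flats A \<and> dim (c u) = u"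
        "\<And>u v. u \<in> S \<Longrightarrow> v \<in> S \<Longrightarrow> u \<le> v \<Longrightarrow> c u \<subseteq> c v"
        by (auto simp: flags_def)
      then show "g \<in> flags A S" by (simp add: flags_def g)
    qed
    show "(\<lambda>c. c(t := X)) ` flags A S \<subseteq> flags A (insert t S)"
    proof
      fix g assume "g \<in> (\<lambda>c. c(t := X)) ` flags A S"
      then obtain c where c: "c \<in> flags A S" and g: "g = c(t := X)" by blast
      have cS: "c u \<in> flats A" "dim (c u) = u" if "u \<in> S" for u
        using c that by (auto simp: flags_def)
      have "g \<in> insert t S \<rightarrow>\<^sub>E flats A"
        using c X by (auto simp: flags_def g PiE_def extensional_def)
      moreover have "c u \<subseteq> X" if "u \<in> S" "u \<le> t" for u
        using below[of "c u"] cS that by auto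
      moreover have "X \<subseteq> c u" if "u \<in> S" "t \<le> u" for u
        using above[of "c u"] cS that by auto
      ultimately show "g \<in> flags A (insert t S)"
        using c X unfolding flags_def g by (auto split: if_splits)
    qed
  qed
  then show ?thesis by (rule bij_betw_same_card)
qed

lemma card_flags_minus_zero: "card (flags A (S - {0})) = card (flags A S)"
proof (cases "0 \<in> S")
  case True
  have "card (flags A (insert 0 (S - {0}))) = card (flags A (S - {0}))"
  proof (rule card_flags_insert[OF zero_in_flats])
    show "F = {0}" if "F \<in> flats A" "dim F = 0" for F
      using that subspace_flat[OF that(1)] by (auto simp: subspace_0)
  qed (auto dest: subspace_flat[THEN subspace_0])
  with True show ?thesis by (simp add: insert_absorb)
qed simp

text \<open>The only flat of dimension at least \<open>t\<close> is \<open>span A\<close>. For sets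
  spanning a hyperplane this identifies the flag numbers of \<open>S\<close> and of \<open>S\<close>
  with the top dimension added.\<close>

lemma card_flags_insert_top:
  assumes "dim (span A) = t" "t \<notin> S"
  shows "card (flags A (insert t S)) = card (flags A S)"
proof (rule card_flags_insert[OF span_in_flats assms])
  have *: "F = span A" if "F \<in> flats A" "t \<le> dim F" for F
    using that assms(1) flat_subset_span[OF that(1)] subspace_dim_equal[of F "span A"]
      subspace_flat[OF that(1)] by simp
  show "F = span A" if "F \<in> flats A" "dim F = t" for F
    using that * by simp
  show "span A \<subseteq> F" if "F \<in> flats A" "t \<le> dim F" for F
    using that * by simp
qed (auto dest: flat_subset_span)

subsection \<open>Adding a generic vector\<close>

text \<open>Here \<open>D\<close> stands for the dimension of the space from which \<open>p\<close>
  is taken. Bounding the dimension by \<open>D\<close> instead of speaking of proper flats covers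
  non-spanning \<open>A\<close> too: then \<open>span A\<close> is itself among the flats that
  \<open>p\<close> avoids.\<close>

locale generic_extension =
  fixes A :: "'a::euclidean_space set" and p :: 'a and D :: nat
  assumes finite_A: "finite A" and generic: "\<And>F. F \<in> flats A \<Longrightarrow> dim F < D \<Longrightarrow> p \<notin> F"
begin

text \<open>Exchange property: a generator \<open>b\<close> of \<open>F\<close> outside
  \<open>G\<close> would put \<open>p\<close> into \<open>span (insert b G)\<close>, a flat of
  \<open>A\<close> of dimension \<open>dim G + 1 < D\<close>. Thus joining \<open>p\<close> to
  \<open>G\<close> captures no new vector of \<open>A\<close>.\<close>

lemma subset_of_subset_span_insert:
  assumes F: "F \<in> flats A" and G: "G \<in> flats A" "dim G + 1 < D"
    and FG: "F \<subseteq> span (insert p G)"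
  shows "F \<subseteq> G"
proof -
  obtain B where B: "B \<subseteq> A" "F = span B" using F by (auto simp: flats_def)
  have "b \<in> G" if "b \<in> B" for b
  proof (rule ccontr)
    assume b: "b \<notin> G"
    have "b \<in> span (insert p G)" using that B FG span_base by blast
    with b have "p \<in> span (insert b G)"
      using in_span_insert[of b p G] by (simp add: span_flat[OF G(1)])
    moreover have "span (insert b G) \<in> flats A"
      using span_insert_flat[OF G(1)] that B by blast
    ultimately show False
      using generic dim_span_insert_notin[OF G(1) b] G(2) by auto
  qed
  then show ?thesis
    unfolding B(2) using span_minimal[of B G] subspace_flat[OF G(1)] by blast
qed

lemma flat_without_p:
  assumes "H \<in> flats (insert p A)" "p \<notin> H"
  shows "H \<in> flats A"
proof -
  obtain B where B: "B \<subseteq> insert p A" "H = span B" using assms by (auto simp: flats_def)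
  with assms(2) have "p \<notin> B" using span_base by blast
  with B show ?thesis by (auto simp: flats_def)
qed

text \<open>A generating subset of \<open>H\<close> has to contain \<open>p\<close>, as otherwise
  \<open>H\<close> would be a flat of \<open>A\<close> that \<open>p\<close> avoids. Its other
  elements span \<open>F\<close>.\<close>

lemma flat_with_p:
  assumes "H \<in> flats (insert p A)" "p \<in> H" "dim H < D"
  obtains F where "F \<in> flats A" "H = span (insert p F)" "dim F + 1 = dim H"
proof -
  obtain B where B: "B \<subseteq> insert p A" "H = span B" using assms by (auto simp: flats_def)
  have "p \<in> B"
  proof (rule ccontr)
    assume "p \<notin> B"
    with B have "H \<in> flats A" by (auto simp: flats_def)
    with assms generic show False by blast
  qed
  define F where "F = span (B - {p})"
  have F: "F \<in> flats A" using B by (auto simp: F_def flats_def)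
  have H: "H = span (insert p F)"
    using \<open>p \<in> B\<close> by (simp add: F_def span_insert_span B insert_absorb)
  have "F \<subseteq> H" unfolding F_def B by (rule span_mono) auto
  then have "dim F < D" using assms(3) dim_subset[of F H] by simp
  then have "dim F + 1 = dim H"
    unfolding H using generic[OF F] dim_span_insert_notin[OF F] by simp
  with F H that show thesis by blast
qed

lemma extend_by_p:
  assumes "F \<in> flats A" "dim F < D"
  shows "span (insert p F) \<in> flats (insert p A)" "dim (span (insert p F)) = dim F + 1"
  using assms flats_mono[of A "insert p A"] span_insert_flat[of F "insert p A" p]
    dim_span_insert_notin generic by blast+

text \<open>The index \<open>s\<close> is the first dimension at which the flag contains
  \<open>p\<close>; by monotonicity all later members contain \<open>p\<close> as well.\<close>

definition flags_from :: "nat set \<Rightarrow> nat \<Rightarrow> (nat \<Rightarrow> 'a set) set" where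
  "flags_from S s = {g \<in> flags (insert p A) S. p \<in> g s \<and> (\<forall>t\<in>S. t < s \<longrightarrow> p \<notin> g t)}"

text \<open>A flag whose members contain \<open>p\<close> from dimension \<open>s\<close> on is obtained from a flag of \<open>A\<close> by joining
  \<open>p\<close> to these members. If \<open>s - 1 \<in> S\<close>, the members of dimension \<open>s - 1\<close> and \<open>s\<close> come from the same
  flat of \<open>A\<close>, by genericity of \<open>p\<close>, so the set \<open>pull_down s S\<close> of their dimensions loses an element.\<close>

lemma card_flags_from:
  assumes S: "S \<subseteq> {1..<D}" and s: "s \<in> S"
  shows "card (flags_from S s) = card (flags A (pull_down s S))"
proof -
  let ?R = "pull_down s S"
  let ?h = "\<lambda>c. \<lambda>t\<in>S. if t < s then c t else span (insert p (c (t - 1)))"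
  have R1: "t \<in> ?R" if "t \<in> S" "t < s" for t using that by (auto simp: pull_down_def)
  have R2: "t - 1 \<in> ?R" if "t \<in> S" "s \<le> t" for t using that by (auto simp: pull_down_def)
  have R3: "(r \<in> S \<and> r < s) \<or> (r + 1 \<in> S \<and> s \<le> r + 1)" if "r \<in> ?R" for r
  proof -
    consider "r \<in> S" "r < s" | x where "x \<in> S" "s \<le> x" "r = x - 1"
      using \<open>r \<in> ?R\<close> by (auto simp: pull_down_def)
    then show ?thesis
    proof cases
      case 2
      moreover from 2 S have "1 \<le> x" by auto
      ultimately show ?thesis by simp
    qed simp
  qed
  have SD: "1 \<le> t" "t < D" if "t \<in> S" for t using S that by auto
  have "bij_betw ?h (flags A ?R) (flags_from S s)"
    unfolding bij_betw_def
  proof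
    have cR: "c r \<in> flats A" "dim (c r) = r" if "c \<in> flags A ?R" "r \<in> ?R" for c r
      using that by (auto simp: flags_def)
    show "inj_on ?h (flags A ?R)"
    proof
      fix c c' assume c: "c \<in> flags A ?R" and c': "c' \<in> flags A ?R" and eq: "?h c = ?h c'"
      show "c = c'"
      proof
        fix r
        show "c r = c' r"
        proof (cases "r \<in> ?R")
          case False
          with c c' show ?thesis by (auto simp: flags_def PiE_def extensional_def)
        next
          case True
          from R3[OF this] show ?thesis
          proof
            assume "r \<in> S \<and> r < s"
            then show ?thesis using fun_cong[OF eq, of r] by simp
          next
            assume r: "r + 1 \<in> S \<and> s \<le> r + 1"
            then have e: "span (insert p (c r)) = span (insert p (c' r))"
              using fun_cong[OF eq, of "r + 1"] by simp
            \<comment> \<open>As \<open>dim (c r) = r\<close>, this is the bound under which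
              \<open>p\<close> can be cancelled from both spans.\<close>
            have D: "r + 1 < D" using r SD by blast
            have "c r \<subseteq> span (insert p (c' r))" "c' r \<subseteq> span (insert p (c r))"
              using e span_superset[of "insert p (c r)"] span_superset[of "insert p (c' r)"] by auto
            then show ?thesis
              using subset_of_subset_span_insert cR[OF c True] cR[OF c' True] D by (metis antisym)
          qed
        qed
      qed
    qed
    show "?h ` flags A ?R = flags_from S s"
    proof
      show "?h ` flags A ?R \<subseteq> flags_from S s"
      proof
        fix g assume "g \<in> ?h ` flags A ?R"
        then obtain c where c: "c \<in> flags A ?R" and g: "g = ?h c" by blast
        have g1: "g t = c t" if "t \<in> S" "t < s" for t using that by (simp add: g)
        have g2: "g t = span (insert p (c (t - 1)))" if "t \<in> S" "s \<le> t" for t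
          using that by (simp add: g)
        have mono: "c r \<subseteq> c r'" if "r \<in> ?R" "r' \<in> ?R" "r \<le> r'" for r r'
          using c that by (auto simp: flags_def)
        have flat: "g t \<in> flats (insert p A)" "dim (g t) = t" if "t \<in> S" for t
        proof -
          consider "t < s" | "s \<le> t" by linarith
          then have "g t \<in> flats (insert p A) \<and> dim (g t) = t"
          proof cases
            case 1
            then show ?thesis
              using cR[OF c R1[OF that 1]] g1[OF that] flats_mono[of A "insert p A"] by auto
          next
            case 2
            have "dim (c (t - 1)) < D" "dim (c (t - 1)) + 1 = t"
              using cR[OF c R2[OF that 2]] SD[OF that] by auto
            then show ?thesis
              using extend_by_p[OF cR(1)[OF c R2[OF that 2]]] g2[OF that 2] by simp
          qed
          then show "g t \<in> flats (insert p A)" "dim (g t) = t" by auto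
        qed
        have "g \<in> S \<rightarrow>\<^sub>E flats (insert p A)"
          using flat by (auto simp: PiE_def extensional_def g)
        moreover have "g t \<subseteq> g u" if tu: "t \<in> S" "u \<in> S" "t \<le> u" for t u
        proof -
          consider "u < s" | "t < s" "s \<le> u" | "s \<le> t" by linarith
          then show ?thesis
          proof cases
            case 1
            then show ?thesis using mono[OF R1 R1] g1 tu by simp
          next
            case 2
            \<comment> \<open>From \<open>t < s \<le> u\<close> follows
              \<open>t \<le> u - 1\<close>, so monotonicity of \<open>c\<close> applies across the
              threshold \<open>s\<close>.\<close>
            then have "g t \<subseteq> c (u - 1)" using mono[OF R1 R2] g1 tu by simp
            also have "\<dots> \<subseteq> g u" using 2 tu g2 span_superset by fastforce
            finally show ?thesis .
          next
            case 3
            then have "c (t - 1) \<subseteq> c (u - 1)" using mono[OF R2 R2] tu by simp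
            then show ?thesis using 3 tu g2 span_mono[OF insert_mono] by simp
          qed
        qed
        moreover have "p \<in> g s" using g2[OF s] span_base[of p] by simp
        moreover have "p \<notin> g t" if "t \<in> S" "t < s" for t
          using generic[OF cR(1)[OF c R1]] cR(2)[OF c R1] g1 that SD by simp
        ultimately show "g \<in> flags_from S s"
          using flat by (simp add: flags_from_def flags_def)
      qed
      show "flags_from S s \<subseteq> ?h ` flags A ?R"
      proof
        fix g assume "g \<in> flags_from S s"
        then have gE: "g \<in> S \<rightarrow>\<^sub>E flats (insert p A)"
          and gflat: "\<And>t. t \<in> S \<Longrightarrow> g t \<in> flats (insert p A) \<and> dim (g t) = t"
          and gmono: "\<And>t u. t \<in> S \<Longrightarrow> u \<in> S \<Longrightarrow> t \<le> u \<Longrightarrow> g t \<subseteq> g u"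
          and ps: "p \<in> g s" and pt: "\<And>t. t \<in> S \<Longrightarrow> t < s \<Longrightarrow> p \<notin> g t"
          by (auto simp: flags_from_def flags_def)
        have "\<exists>F. F \<in> flats A \<and> g t = span (insert p F) \<and> dim F + 1 = t"
          if "t \<in> S" "s \<le> t" for t
        proof -
          have "p \<in> g t" "dim (g t) < D" "dim (g t) = t" "g t \<in> flats (insert p A)"
            using gflat[OF that(1)] gmono[OF s that] ps SD[OF that(1)] by auto
          then show ?thesis using flat_with_p[of "g t"] by metis
        qed
        then obtain f where
          f: "\<And>t. t \<in> S \<Longrightarrow> s \<le> t \<Longrightarrow> f t \<in> flats A"
          and gf: "\<And>t. t \<in> S \<Longrightarrow> s \<le> t \<Longrightarrow> g t = span (insert p (f t))"
          and df: "\<And>t. t \<in> S \<Longrightarrow> s \<le> t \<Longrightarrow> dim (f t) + 1 = t"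
          by metis
        have small: "g t \<in> flats A" if "t \<in> S" "t < s" for t
          using flat_without_p gflat pt that by blast
        \<comment> \<open>\<open>g t\<close> is a flat of \<open>A\<close> inside
          \<open>span (insert p (f u))\<close>, so genericity pushes it into
          \<open>f u\<close>.\<close>
        have low: "g t \<subseteq> f u" if "t \<in> S" "t < s" "u \<in> S" "s \<le> u" for t u
          using subset_of_subset_span_insert[OF small f] gmono[of t u] that gf df SD by simp
        have high: "f t \<subseteq> f u" if "t \<in> S" "s \<le> t" "u \<in> S" "t \<le> u" for t u
        proof -
          have "f t \<subseteq> g t" using gf[OF that(1,2)] span_superset by fastforce
          also have "\<dots> \<subseteq> span (insert p (f u))" using gf[of u] gmono[of t u] that by simp
          finally show ?thesis
            using subset_of_subset_span_insert f[of t] f[of u] df[of u] SD[of u] that by simp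
        qed
        \<comment> \<open>If \<open>s - 1 \<in> S\<close>, there are two candidates for the member
          of dimension \<open>s - 1\<close>: \<open>g (s - 1)\<close> and \<open>f s\<close>. The
          definition takes the latter; \<open>c1\<close> shows that they agree, by
          \<open>low\<close> and equality of dimensions.\<close>
        define c where "c = (\<lambda>r\<in>?R. if r + 1 \<in> S \<and> s \<le> r + 1 then f (r + 1) else g r)"
        have c1: "c t = g t" if t: "t \<in> S" "t < s" for t
        proof (cases "t + 1 \<in> S \<and> s \<le> t + 1")
          case True
          then have "c t = f (t + 1)" using R1[OF that] by (simp add: c_def)
          moreover have "g t = f (t + 1)"
            using subspace_dim_equal[of "g t" "f (t + 1)"] low[of t "t + 1"] True t
              subspace_flat[OF small] subspace_flat[OF f] df[of "t + 1"] gflat[of t] by simp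
          ultimately show ?thesis by simp
        next
          case False
          then show ?thesis using R1[OF that] by (auto simp: c_def)
        qed
        have c2: "c (t - 1) = f t" if t: "t \<in> S" "s \<le> t" for t
          using R2[OF that] SD[OF t(1)] t by (simp add: c_def)
        have cflat: "c r \<in> flats A \<and> dim (c r) = r" if "r \<in> ?R" for r
          using R3[OF that]
        proof
          assume "r \<in> S \<and> r < s"
          then show ?thesis using c1[of r] small[of r] gflat[of r] by simp
        next
          assume "r + 1 \<in> S \<and> s \<le> r + 1"
          then show ?thesis using c2[of "r + 1"] f[of "r + 1"] df[of "r + 1"] by simp
        qed
        have cmono: "c r \<subseteq> c u" if "r \<in> ?R" "u \<in> ?R" "r \<le> u" for r u
          using R3[OF that(1)]
        proof
          assume r: "r \<in> S \<and> r < s"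
          show ?thesis using R3[OF that(2)]
          proof
            assume "u \<in> S \<and> u < s"
            then show ?thesis using r c1 gmono that by simp
          next
            assume "u + 1 \<in> S \<and> s \<le> u + 1"
            then show ?thesis using r c1[of r] c2[of "u + 1"] low[of r "u + 1"] by simp
          qed
        next
          assume r: "r + 1 \<in> S \<and> s \<le> r + 1"
          show ?thesis
          proof (cases "r = u")
            case False
            then have "u + 1 \<in> S \<and> s \<le> u + 1" using R3[OF that(2)] that(3) r by auto
            then show ?thesis
              using r c2[of "r + 1"] c2[of "u + 1"] high[of "r + 1" "u + 1"] that by simp
          qed simp
        qed
        have "c \<in> flags A ?R"
          using cflat cmono by (auto simp: flags_def PiE_def c_def)
        moreover have "?h c = g"
        proof
          fix t show "?h c t = g t"
            using c1[of t] c2[of t] gf[of t] gE by (auto simp: PiE_def extensional_def)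
        qed
        ultimately show "g \<in> ?h ` flags A ?R" by blast
      qed
    qed
  qed
  then show ?thesis by (simp add: bij_betw_same_card)
qed

text \<open>This is the operator \<open>T = 1 + E\<close> of the overview. New flags are sorted by
  the first dimension at which they contain \<open>p\<close>; those that never do are exactly the
  flags of \<open>A\<close>.\<close>

lemma card_flags_insert_generic:
  assumes S: "S \<subseteq> {1..<D}"
  shows "card (flags (insert p A) S)
    = card (flags A S) + (\<Sum>s\<in>S. card (flags A (pull_down s S - {0})))"
proof -
  have finS: "finite S" using S finite_subset by blast
  have fin: "finite (flags (insert p A) S)" using finite_A finS by (simp add: finite_flags)
  have sub: "flags A S \<subseteq> flags (insert p A) S"
    using flats_mono[of A "insert p A"] by (auto simp: flags_def)
  have notp: "p \<notin> c t" if "c \<in> flags A S" "t \<in> S" for c t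
  proof -
    have "c t \<in> flats A" "dim (c t) = t" using that by (auto simp: flags_def)
    then show ?thesis using generic[of "c t"] S that by auto
  qed
  have split: "flags (insert p A) S = flags A S \<union> (\<Union>s\<in>S. flags_from S s)"
  proof
    show "flags A S \<union> (\<Union>s\<in>S. flags_from S s) \<subseteq> flags (insert p A) S"
      using sub by (auto simp: flags_from_def)
    show "flags (insert p A) S \<subseteq> flags A S \<union> (\<Union>s\<in>S. flags_from S s)"
    proof
      fix g assume g: "g \<in> flags (insert p A) S"
      show "g \<in> flags A S \<union> (\<Union>s\<in>S. flags_from S s)"
      proof (cases "\<exists>s. s \<in> S \<and> p \<in> g s")
        case False
        then have "g t \<in> flats A" if "t \<in> S" for t
          using g that flat_without_p by (auto simp: flags_def)
        then have "g \<in> flags A S" using g by (auto simp: flags_def PiE_def)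
        then show ?thesis by blast
      next
        case True
        define s where "s = (LEAST s. s \<in> S \<and> p \<in> g s)"
        have "s \<in> S \<and> p \<in> g s" unfolding s_def using True by (rule LeastI_ex)
        moreover have "\<forall>t\<in>S. t < s \<longrightarrow> p \<notin> g t"
          unfolding s_def using not_less_Least by blast
        ultimately have "g \<in> flags_from S s" using g by (simp add: flags_from_def)
        then show ?thesis using \<open>s \<in> S \<and> p \<in> g s\<close> by blast
      qed
    qed
  qed
  have disj: "flags A S \<inter> (\<Union>s\<in>S. flags_from S s) = {}"
    using notp by (auto simp: flags_from_def)
  have disj2: "flags_from S s \<inter> flags_from S s' = {}" if "s \<in> S" "s' \<in> S" "s \<noteq> s'" for s s'
    using that by (auto simp: flags_from_def neq_iff)
  have fin2: "finite (flags_from S s)" for s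
    using fin by (auto simp: flags_from_def)
  have "card (flags (insert p A) S) = card (flags A S) + card (\<Union>s\<in>S. flags_from S s)"
    unfolding split by (rule card_Un_disjoint) (use finite_A finS fin2 disj in \<open>auto simp: finite_flags\<close>)
  also have "card (\<Union>s\<in>S. flags_from S s) = (\<Sum>s\<in>S. card (flags_from S s))"
    using finS fin2 disj2 by (simp add: card_UN_disjoint)
  also have "\<dots> = (\<Sum>s\<in>S. card (flags A (pull_down s S - {0})))"
    using card_flags_from[OF S] by (simp add: card_flags_minus_zero)
  finally show ?thesis .
qed

end

text \<open>Induction on the family: if a vector \<open>p\<close> avoiding the earlier subspaces
  lies in the new one, \<open>T\<close>, it is moved along a direction \<open>x\<close> of
  \<open>V\<close> outside \<open>T\<close>. Only finitely many multiples of \<open>x\<close> are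
  bad.\<close>

lemma avoid_proper_subspaces:
  fixes V :: "'a::real_vector set"
  assumes "finite \<F>" "subspace V" "\<And>T. T \<in> \<F> \<Longrightarrow> subspace T \<and> \<not> V \<subseteq> T"
  shows "\<exists>p\<in>V. \<forall>T\<in>\<F>. p \<notin> T"
  using assms(1,3)
proof (induction \<F>)
  case empty
  then show ?case using subspace_0[OF assms(2)] by auto
next
  case (insert T \<F>)
  then obtain p where p: "p \<in> V" "\<forall>U\<in>\<F>. p \<notin> U" by auto
  obtain x where x: "x \<in> V" "x \<notin> T" using insert.prems by blast
  have subT: "subspace U" if "U \<in> insert T \<F>" for U using insert.prems that by blast
  show ?case
  proof (cases "p \<in> T")
    case True
    have "finite {r. p + r *\<^sub>R x \<in> U}" if "U \<in> \<F>" for U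
    proof -
      \<comment> \<open>Two points of the line in \<open>U\<close> would put \<open>x\<close>, and
        then \<open>p\<close>, into \<open>U\<close>.\<close>
      have "r = r'" if r: "p + r *\<^sub>R x \<in> U" "p + r' *\<^sub>R x \<in> U" for r r'
      proof (rule ccontr)
        assume "r \<noteq> r'"
        have U: "subspace U" using subT \<open>U \<in> \<F>\<close> by blast
        have "(p + r *\<^sub>R x) - (p + r' *\<^sub>R x) \<in> U" using subspace_diff[OF U r] .
        then have "(r - r') *\<^sub>R x \<in> U" by (simp add: algebra_simps)
        then have "(1 / (r - r')) *\<^sub>R (r - r') *\<^sub>R x \<in> U" using subspace_scale[OF U] by blast
        then have "x \<in> U" using \<open>r \<noteq> r'\<close> by simp
        then have "(p + r *\<^sub>R x) - r *\<^sub>R x \<in> U"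
          using subspace_diff[OF U r(1)] subspace_scale[OF U] by blast
        then show False using p \<open>U \<in> \<F>\<close> by simp
      qed
      then have "{r. p + r *\<^sub>R x \<in> U} = {} \<or> (\<exists>r. {r. p + r *\<^sub>R x \<in> U} = {r})" by blast
      then show ?thesis by (metis finite.emptyI finite.insertI)
    qed
    \<comment> \<open>Excluding \<open>0\<close> forces the moved vector to leave
      \<open>T\<close>.\<close>
    then have "finite (insert 0 (\<Union>U\<in>\<F>. {r. p + r *\<^sub>R x \<in> U}))" using insert.hyps by simp
    then obtain r where "r \<notin> insert 0 (\<Union>U\<in>\<F>. {r. p + r *\<^sub>R x \<in> U})"
      using ex_new_if_finite[OF infinite_UNIV_char_0] by blast
    then have r: "r \<noteq> 0" "\<forall>U\<in>\<F>. p + r *\<^sub>R x \<notin> U" by auto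
    have "p + r *\<^sub>R x \<notin> T"
    proof
      assume "p + r *\<^sub>R x \<in> T"
      then have "(p + r *\<^sub>R x) - p \<in> T" using subspace_diff[OF subT[of T]] True by blast
      then have "r *\<^sub>R x \<in> T" by simp
      then have "(1 / r) *\<^sub>R r *\<^sub>R x \<in> T" using subspace_scale[OF subT[of T]] by blast
      then show False using r x by simp
    qed
    moreover have "p + r *\<^sub>R x \<in> V"
      using p x subspace_add[OF assms(2)] subspace_scale[OF assms(2)] by blast
    ultimately show ?thesis using r by blast
  qed (use p in blast)
qed

subsection \<open>Functionals on flag-vectors\<close>

lemma sum_Pow_insert:
  fixes f :: "'b set \<Rightarrow> 'c::comm_monoid_add"
  assumes "finite X" "x \<notin> X"
  shows "(\<Sum>S\<in>Pow (insert x X). f S) = (\<Sum>S\<in>Pow X. f S + f (insert x S))"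
proof -
  have "(\<Sum>S\<in>Pow (insert x X). f S) = sum f (Pow X) + sum f (insert x ` Pow X)"
    unfolding Pow_insert using assms by (intro sum.union_disjoint) auto
  also have "sum f (insert x ` Pow X) = (\<Sum>S\<in>Pow X. f (insert x S))"
    using assms(2) by (subst sum.reindex) (auto simp: inj_on_def)
  finally show ?thesis by (simp add: sum.distrib)
qed

lemma sum_Pow_upto:
  fixes f :: "nat set \<Rightarrow> real"
  assumes "1 \<le> i"
  shows "(\<Sum>S\<in>Pow {1..i}. f S) = (\<Sum>S\<in>Pow {1..<i}. f S + f (insert i S))"
proof -
  have "{1..i} = insert i {1..<i}" using assms by auto
  then show ?thesis using sum_Pow_insert[of "{1..<i}" i f] by simp
qed

section \<open>Lowering the elements of a rank set\<close>

abbreviation lowered :: "nat \<Rightarrow> nat set \<Rightarrow> nat set" where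
  "lowered s S \<equiv> pull_down s S - {0}"

text \<open>Every element either lies below \<open>s \<le> i\<close> or is decreased, so
  \<open>i\<close> cannot survive.\<close>

lemma lowered_subset: "S \<subseteq> {1..i} \<Longrightarrow> s \<in> S \<Longrightarrow> lowered s S \<subseteq> {1..<i}"
proof
  fix x assume S: "S \<subseteq> {1..i}" "s \<in> S" and x: "x \<in> lowered s S"
  from x consider "x \<noteq> 0" "x < s" | y where "x \<noteq> 0" "x = y - 1" "y \<in> S"
    unfolding pull_down_def by (elim DiffE UnE imageE) auto
  then show "x \<in> {1..<i}"
  proof cases
    case 1
    moreover have "s \<le> i" using S by auto
    ultimately show ?thesis by simp
  next
    case 2
    moreover have "y \<le> i" using S 2 by auto
    ultimately show ?thesis by auto
  qed
qed

lemma lowered_insert_less: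
  assumes "S \<subseteq> {1..<i}" "s \<in> S"
  shows "lowered s (insert i S) = insert (i - 1) (lowered s S)"
proof -
  have s: "1 \<le> s" "s < i" using assms by auto
  then have "{x \<in> insert i S. x < s} = {x \<in> S. x < s}"
    "{x \<in> insert i S. s \<le> x} = insert i {x \<in> S. s \<le> x}" by auto
  then show ?thesis using s by (simp add: pull_down_def insert_Diff_if)
qed

text \<open>Only the top element moves; \<open>2 \<le> i\<close> keeps its new value
  \<open>i - 1\<close> from being the discarded \<open>0\<close>.\<close>

lemma lowered_insert_self:
  assumes "S \<subseteq> {1..<i}" "2 \<le> i"
  shows "lowered i (insert i S) = insert (i - 1) S"
proof -
  have "{x \<in> insert i S. x < i} = S" "{x \<in> insert i S. i \<le> x} = {i}"
    using assms by auto
  moreover have "0 \<notin> S" using assms(1) by auto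
  ultimately show ?thesis using assms(2) by (simp add: pull_down_def insert_Diff_if)
qed

text \<open>The hypotheses say that \<open>\<alpha>\<close> changes sign when the top rank is added,
  and that \<open>\<alpha> \<circ> E = 0\<close>. Splitting the second relation by membership of
  \<open>Suc i\<close> and using the first yields both relations for \<open>i\<close>, so induction
  applies.\<close>

lemma functional_eq_zero:
  fixes \<alpha> :: "nat set \<Rightarrow> real"
  assumes "1 \<le> i"
    and "\<And>S. S \<subseteq> {1..<i} \<Longrightarrow> \<alpha> (insert i S) = - \<alpha> S"
    and "\<And>w. (\<Sum>S\<in>Pow {1..i}. \<alpha> S * (\<Sum>s\<in>S. w (lowered s S))) = 0"
    and "S \<subseteq> {1..i}"
  shows "\<alpha> S = 0"
  using assms
proof (induction i arbitrary: S rule: dec_induct)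
  case base
  have "lowered (Suc 0) {Suc 0} = {}" by (auto simp: pull_down_def)
  then have "\<alpha> {1} = 0" using base.prems(2)[of "\<lambda>_. 1"] by (simp add: Pow_insert)
  moreover have "\<alpha> {1} = - \<alpha> {}" using base.prems(1)[of "{}"] by simp
  moreover have "S = {} \<or> S = {1}" using base.prems(3) by auto
  ultimately show ?case by auto
next
  case (step i)
  let ?E = "\<lambda>w S. \<Sum>s\<in>S. w (lowered s S)"
  have Suci: "{1..<Suc i} = {1..i}" by auto
  have anti: "\<alpha> (insert (Suc i) S) = - \<alpha> S" if "S \<subseteq> {1..i}" for S
    using step.prems(1)[of S] that Suci by simp
  have E_insert: "?E w (insert (Suc i) S) = ?E (\<lambda>R. w (insert i R)) S + w (insert i S)"
    if "S \<in> Pow {1..i}" for w :: "nat set \<Rightarrow> real" and S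
  proof -
    have S: "S \<subseteq> {1..<Suc i}" "Suc i \<notin> S" "finite S"
      using that finite_subset[of S "{1..i}"] by auto
    have "?E w (insert (Suc i) S)
        = w (lowered (Suc i) (insert (Suc i) S)) + (\<Sum>s\<in>S. w (lowered s (insert (Suc i) S)))"
      using S by simp
    also have "lowered (Suc i) (insert (Suc i) S) = insert i S"
      using lowered_insert_self[OF S(1)] step.hyps by simp
    also have "(\<Sum>s\<in>S. w (lowered s (insert (Suc i) S))) = ?E (\<lambda>R. w (insert i R)) S"
      using lowered_insert_less[OF S(1)] by simp
    finally show ?thesis by simp
  qed
  have key: "(\<Sum>S\<in>Pow {1..i}. \<alpha> S * (?E w S - ?E (\<lambda>R. w (insert i R)) S - w (insert i S))) = 0" for w
  proof -
    have "0 = (\<Sum>S\<in>Pow {1..Suc i}. \<alpha> S * ?E w S)" using step.prems(2) by simp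
    also have "\<dots> = (\<Sum>S\<in>Pow {1..i}. \<alpha> S * ?E w S + \<alpha> (insert (Suc i) S) * ?E w (insert (Suc i) S))"
      using sum_Pow_upto[of "Suc i"] Suci by simp
    also have "\<dots> = (\<Sum>S\<in>Pow {1..i}. \<alpha> S * (?E w S - ?E (\<lambda>R. w (insert i R)) S - w (insert i S)))"
      using anti E_insert by (intro sum.cong refl) (simp add: algebra_simps)
    finally show ?thesis by simp
  qed
  have E_zero: "(\<Sum>S\<in>Pow {1..i}. \<alpha> S * ?E w S) = 0" for w
  proof -
    \<comment> \<open>Setting \<open>w\<close> to zero on sets containing \<open>i\<close> kills the
      last two terms of \<open>key\<close> but leaves the first unchanged, since lowered sets never
      contain \<open>i\<close>.\<close>
    let ?w = "\<lambda>R. if i \<in> R then 0 else w R"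
    have "0 = (\<Sum>S\<in>Pow {1..i}. \<alpha> S * ?E ?w S)" using key[of ?w] by simp
    also have "\<dots> = (\<Sum>S\<in>Pow {1..i}. \<alpha> S * ?E w S)"
    proof (intro sum.cong refl arg_cong2[of _ _ _ _ "(*)"])
      fix S s assume "S \<in> Pow {1..i}" "s \<in> S"
      then have "i \<notin> lowered s S" using lowered_subset[of S i s] by auto
      then show "?w (lowered s S) = w (lowered s S)" by presburger
    qed
    finally show ?thesis by simp
  qed
  have insert_zero: "(\<Sum>S\<in>Pow {1..i}. \<alpha> S * w (insert i S)) = 0" for w
    using key[of w] E_zero[of w] E_zero[of "\<lambda>R. w (insert i R)"]
    by (simp add: right_diff_distrib sum_subtractf)
  have zero: "\<alpha> S = 0" if "S \<subseteq> {1..i}" for S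
  proof (rule step.IH)
    fix S assume S: "S \<subseteq> {1..<i}"
    \<comment> \<open>Exactly \<open>R = S\<close> and \<open>R = insert i S\<close> satisfy
      \<open>insert i R = insert i S\<close>, so this indicator extracts
      \<open>\<alpha> S + \<alpha> (insert i S)\<close>.\<close>
    let ?w = "\<lambda>R. of_bool (R = insert i S) :: real"
    have "0 = (\<Sum>R\<in>Pow {1..i}. \<alpha> R * ?w (insert i R))" using insert_zero[of ?w] by (rule sym)
    also have "\<dots> = (\<Sum>R\<in>Pow {1..<i}. \<alpha> R * ?w (insert i R) + \<alpha> (insert i R) * ?w (insert i R))"
      by (simp only: sum_Pow_upto[OF step.hyps(1)] insert_absorb2)
    also have "\<dots> = (\<Sum>R\<in>Pow {1..<i}. if R = S then \<alpha> R + \<alpha> (insert i R) else 0)"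
    proof (intro sum.cong refl)
      fix R assume "R \<in> Pow {1..<i}"
      then have "insert i R = insert i S \<longleftrightarrow> R = S"
        using S by (auto simp: insert_ident subset_iff)
      then show "\<alpha> R * ?w (insert i R) + \<alpha> (insert i R) * ?w (insert i R)
          = (if R = S then \<alpha> R + \<alpha> (insert i R) else 0)" by simp
    qed
    also have "\<dots> = \<alpha> S + \<alpha> (insert i S)" using S by simp
    finally show "\<alpha> (insert i S) = - \<alpha> S" by simp
  qed (use E_zero that in auto)
  show ?case
  proof (cases "Suc i \<in> S")
    case True
    have "S - {Suc i} \<subseteq> {1..i}" using step.prems(3) by fastforce
    then show ?thesis
      using anti[of "S - {Suc i}"] zero[of "S - {Suc i}"] True by (simp add: insert_absorb)
  next
    case False
    then have "S \<subseteq> {1..i}" using step.prems(3) by (auto simp: le_Suc_eq subset_iff)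
    then show ?thesis by (rule zero)
  qed
qed

text \<open>The coefficients of \<open>\<alpha> \<circ> T\<close>, obtained from the transposed
  matrix of \<open>T\<close>; the first summand is the identity, the second is
  \<open>E\<close>.\<close>

definition adjoint_functional :: "nat \<Rightarrow> (nat set \<Rightarrow> real) \<Rightarrow> nat set \<Rightarrow> real" where
  "adjoint_functional i \<alpha> R =
     (\<Sum>S\<in>Pow {1..i}. \<alpha> S * (of_bool (S = R) + (\<Sum>s\<in>S. of_bool (lowered s S = R))))"

lemma sum_adjoint_functional:
  "(\<Sum>R\<in>Pow {1..i}. adjoint_functional i \<alpha> R * w R)
    = (\<Sum>S\<in>Pow {1..i}. \<alpha> S * (w S + (\<Sum>s\<in>S. w (lowered s S))))"
proof -
  have "(\<Sum>R\<in>Pow {1..i}. adjoint_functional i \<alpha> R * w R)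
      = (\<Sum>S\<in>Pow {1..i}. \<Sum>R\<in>Pow {1..i}.
          \<alpha> S * (of_bool (S = R) + (\<Sum>s\<in>S. of_bool (lowered s S = R))) * w R)"
    unfolding adjoint_functional_def sum_distrib_right by (rule sum.swap)
  also have "\<dots> = (\<Sum>S\<in>Pow {1..i}. \<alpha> S * (w S + (\<Sum>s\<in>S. w (lowered s S))))"
  proof (rule sum.cong[OF refl])
    fix S assume S: "S \<in> Pow {1..i}"
    have delta: "(\<Sum>R\<in>Pow {1..i}. of_bool (X = R) * w R) = w X" if "X \<in> Pow {1..i}" for X
    proof -
      have "(\<Sum>R\<in>Pow {1..i}. of_bool (X = R) * w R) = (\<Sum>R\<in>Pow {1..i}. if X = R then w R else 0)"
        by (intro sum.cong) auto
      then show ?thesis using that by simp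
    qed
    have low: "lowered s S \<in> Pow {1..i}" if "s \<in> S" for s
      using lowered_subset[of S i s] S that by fastforce
    have "(\<Sum>R\<in>Pow {1..i}. (\<Sum>s\<in>S. of_bool (lowered s S = R)) * w R)
        = (\<Sum>s\<in>S. \<Sum>R\<in>Pow {1..i}. of_bool (lowered s S = R) * w R)"
      unfolding sum_distrib_right by (rule sum.swap)
    also have "\<dots> = (\<Sum>s\<in>S. w (lowered s S))"
      using delta low by (intro sum.cong) auto
    finally show "(\<Sum>R\<in>Pow {1..i}. \<alpha> S * (of_bool (S = R) + (\<Sum>s\<in>S. of_bool (lowered s S = R))) * w R)
        = \<alpha> S * (w S + (\<Sum>s\<in>S. w (lowered s S)))"
      using delta[OF S] by (simp add: distrib_right distrib_left sum.distrib mult.assoc flip: sum_distrib_left)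
  qed
  finally show ?thesis .
qed

text \<open>No element grows, \<open>s\<close> itself drops by one, and merging elements only loses
  more. Hence the sum of elements is a weight with respect to which \<open>T\<close> is
  unitriangular.\<close>

lemma sum_lowered_less:
  assumes "S \<subseteq> {1..i}" "s \<in> S"
  shows "\<Sum>(lowered s S) < \<Sum>S"
proof -
  have fin: "finite S" using assms(1) finite_subset by blast
  let ?f = "\<lambda>x. if x < s then x else x - 1"
  have "lowered s S \<subseteq> ?f ` S" by (auto simp: pull_down_def)
  then have "\<Sum>(lowered s S) \<le> \<Sum>(?f ` S)" using fin by (intro sum_mono2) auto
  also have "\<dots> \<le> (\<Sum>x\<in>S. ?f x)"
    using sum_image_le[OF fin, of "\<lambda>x. x" ?f] by simp
  also have "\<dots> < (\<Sum>x\<in>S. x)"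
    using assms by (intro sum_strict_mono_ex1[OF fin]) (auto intro!: bexI[of _ s])
  finally show ?thesis .
qed

text \<open>Triangularity: let \<open>M\<close> have the largest element sum among the sets where
  \<open>\<alpha>\<close> is nonzero. A set \<open>S\<close> with \<open>lowered s S = M\<close>
  would have a larger sum, so the adjoint has the value \<open>\<alpha> M\<close> at
  \<open>M\<close>.\<close>

lemma adjoint_functional_injective:
  assumes zero: "\<And>R. R \<subseteq> {1..i} \<Longrightarrow> adjoint_functional i \<alpha> R = 0" and "S \<subseteq> {1..i}"
  shows "\<alpha> S = 0"
proof (rule ccontr)
  assume "\<alpha> S \<noteq> 0"
  define P where "P = {R \<in> Pow {1..i}. \<alpha> R \<noteq> 0}"
  have "finite P" "P \<noteq> {}" using \<open>\<alpha> S \<noteq> 0\<close> assms(2) by (auto simp: P_def)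
  then have "Max (sum (\<lambda>x. x) ` P) \<in> sum (\<lambda>x. x) ` P" and "\<And>R. R \<in> P \<Longrightarrow> \<Sum>R \<le> Max (sum (\<lambda>x. x) ` P)"
    by simp_all
  then obtain M where M: "M \<in> P" "\<And>R. R \<in> P \<Longrightarrow> \<Sum>R \<le> \<Sum>M"
    by auto
  have "adjoint_functional i \<alpha> M = (\<Sum>S\<in>Pow {1..i}. if S = M then \<alpha> M else 0)"
    unfolding adjoint_functional_def
  proof (intro sum.cong refl)
    fix S assume S: "S \<in> Pow {1..i}"
    show "\<alpha> S * (of_bool (S = M) + (\<Sum>s\<in>S. of_bool (lowered s S = M))) = (if S = M then \<alpha> M else 0)"
    proof (cases "\<alpha> S = 0")
      case False
      then have "\<Sum>S \<le> \<Sum>M" using M(2) S by (simp add: P_def)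
      then have "lowered s S \<noteq> M" if "s \<in> S" for s
        using sum_lowered_less[of S i s] S that by auto
      then show ?thesis by simp
    qed (use M in \<open>auto simp: P_def\<close>)
  qed
  also have "\<dots> = \<alpha> M" using M(1) by (simp add: P_def)
  finally show False using zero[of M] M(1) by (simp add: P_def)
qed

section \<open>Functionals that vanish on vector configurations\<close>

lemma exists_generic_extension:
  fixes V :: "'a::euclidean_space set"
  assumes "finite A" "subspace V" "dim V = D"
  obtains p where "p \<in> V" "generic_extension A p D"
proof -
  have "\<exists>p\<in>V. \<forall>F\<in>{F \<in> flats A. dim F < D}. p \<notin> F"
  proof (rule avoid_proper_subspaces)
    \<comment> \<open>A flat of dimension below \<open>D = dim V\<close> is too small to contain
      \<open>V\<close>.\<close>
    show "subspace F \<and> \<not> V \<subseteq> F" if "F \<in> {F \<in> flats A. dim F < D}" for F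
      using that subspace_flat[of F A] dim_subset[of V F] assms(3) by auto
  qed (use assms finite_flats[OF assms(1)] in simp_all)
  then show thesis using assms that by (auto simp: generic_extension_def)
qed

abbreviation flag_functional :: "nat \<Rightarrow> (nat set \<Rightarrow> real) \<Rightarrow> 'a::euclidean_space set \<Rightarrow> real" where
  "flag_functional i \<alpha> A \<equiv> \<Sum>S\<in>Pow {1..i}. \<alpha> S * real (card (flags A S))"

lemma flag_functional_insert_generic:
  assumes "generic_extension A p (Suc i)"
  shows "flag_functional i \<alpha> (insert p A) = flag_functional i (adjoint_functional i \<alpha>) A"
proof -
  interpret generic_extension A p "Suc i" by fact
  show ?thesis
    unfolding sum_adjoint_functional
  proof (intro sum.cong refl)
    fix S assume "S \<in> Pow {1..i}"
    then have "S \<subseteq> {1..<Suc i}" by auto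
    from card_flags_insert_generic[OF this]
    show "\<alpha> S * real (card (flags (insert p A) S))
      = \<alpha> S * (real (card (flags A S)) + (\<Sum>s\<in>S. real (card (flags A (lowered s S)))))" by simp
  qed
qed

text \<open>\<open>W\<close> is a hyperplane of \<open>V\<close>, and \<open>complete\<close> is the
  induction hypothesis in rank \<open>i\<close>. Sets spanning \<open>W\<close> yield the sign
  relation for any functional vanishing on all finite subsets of \<open>V\<close>. It is applied to
  \<open>\<alpha>\<close> and to \<open>\<alpha> \<circ> T\<close>, which vanishes too because a
  generic vector can be chosen in \<open>V\<close>.\<close>

lemma functional_vanishing_on_all:
  fixes V W :: "'a::euclidean_space set"
  assumes V: "subspace V" "dim V = Suc i" and W: "subspace W" "W \<subseteq> V" "dim W = i" and "1 \<le> i"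
    and complete: "\<And>\<beta> S. (\<And>A. finite A \<Longrightarrow> A \<subseteq> W \<Longrightarrow> span A = W \<Longrightarrow>
        (\<Sum>S\<in>Pow {1..<i}. \<beta> S * real (card (flags A S))) = 0) \<Longrightarrow> S \<subseteq> {1..<i} \<Longrightarrow> \<beta> S = 0"
    and van: "\<And>A. finite A \<Longrightarrow> A \<subseteq> V \<Longrightarrow> flag_functional i \<alpha> A = 0"
    and "S \<subseteq> {1..i}"
  shows "\<alpha> S = 0"
proof -
  have anti: "\<beta> S + \<beta> (insert i S) = 0"
    if \<beta>: "\<And>A. finite A \<Longrightarrow> A \<subseteq> V \<Longrightarrow> flag_functional i \<beta> A = 0" and "S \<subseteq> {1..<i}" for \<beta> S
  proof (rule complete[of "\<lambda>S. \<beta> S + \<beta> (insert i S)"])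
    fix A assume A: "finite A" "A \<subseteq> W" "span A = W"
    have "0 = flag_functional i \<beta> A" using \<beta>[of A] A W by auto
    also have "\<dots> = (\<Sum>S\<in>Pow {1..<i}. \<beta> S * real (card (flags A S))
        + \<beta> (insert i S) * real (card (flags A (insert i S))))"
      using sum_Pow_upto[OF \<open>1 \<le> i\<close>] by simp
    also have "\<dots> = (\<Sum>S\<in>Pow {1..<i}. (\<beta> S + \<beta> (insert i S)) * real (card (flags A S)))"
    proof (intro sum.cong refl)
      fix S assume "S \<in> Pow {1..<i}"
      then have "i \<notin> S" by auto
      then have "card (flags A (insert i S)) = card (flags A S)"
        using card_flags_insert_top[of A i S] A W by simp
      then show "\<beta> S * real (card (flags A S)) + \<beta> (insert i S) * real (card (flags A (insert i S)))
          = (\<beta> S + \<beta> (insert i S)) * real (card (flags A S))"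
        by (simp add: distrib_right)
    qed
    finally show "(\<Sum>S\<in>Pow {1..<i}. (\<beta> S + \<beta> (insert i S)) * real (card (flags A S))) = 0" by simp
  qed fact
  \<comment> \<open>The sign relation makes \<open>\<beta>\<close> annihilate every vector whose
    entries ignore \<open>i\<close>.\<close>
  have inv: "(\<Sum>S\<in>Pow {1..i}. \<beta> S * w (S - {i})) = 0"
    if \<beta>: "\<And>S. S \<subseteq> {1..<i} \<Longrightarrow> \<beta> S + \<beta> (insert i S) = 0" for \<beta> and w :: "nat set \<Rightarrow> real"
  proof -
    have "(\<Sum>S\<in>Pow {1..i}. \<beta> S * w (S - {i}))
        = (\<Sum>S\<in>Pow {1..<i}. \<beta> S * w (S - {i}) + \<beta> (insert i S) * w (insert i S - {i}))"
      using sum_Pow_upto[OF \<open>1 \<le> i\<close>] by simp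
    also have "\<dots> = (\<Sum>S\<in>Pow {1..<i}. 0)"
    proof (intro sum.cong refl)
      fix S assume "S \<in> Pow {1..<i}"
      then have "(\<beta> S + \<beta> (insert i S)) * w (S - {i}) = 0" using \<beta>[of S] by simp
      then show "\<beta> S * w (S - {i}) + \<beta> (insert i S) * w (insert i S - {i}) = 0"
        by (simp add: distrib_right)
    qed
    finally show ?thesis by simp
  qed
  have adj: "flag_functional i (adjoint_functional i \<alpha>) A = 0" if A: "finite A" "A \<subseteq> V" for A
  proof -
    obtain p where "p \<in> V" and p: "generic_extension A p (Suc i)"
      by (rule exists_generic_extension[OF A(1) V])
    then show ?thesis
      using van[of "insert p A"] A flag_functional_insert_generic[OF p, of \<alpha>] by simp
  qed
  have anti\<alpha>: "\<alpha> S + \<alpha> (insert i S) = 0" if "S \<subseteq> {1..<i}" for S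
    by (rule anti) (use van that in auto)
  have anti_adj: "adjoint_functional i \<alpha> S + adjoint_functional i \<alpha> (insert i S) = 0"
    if "S \<subseteq> {1..<i}" for S
    by (rule anti) (use adj that in auto)
  show ?thesis
  proof (rule functional_eq_zero[OF \<open>1 \<le> i\<close>])
    show "\<alpha> (insert i S) = - \<alpha> S" if "S \<subseteq> {1..<i}" for S
      using anti\<alpha>[OF that] by simp
    fix w :: "nat set \<Rightarrow> real"
    \<comment> \<open>\<open>E\<close> reads only entries at sets without \<open>i\<close>, so
      replacing \<open>w\<close> by \<open>?w\<close> does not change \<open>E w\<close>. On
      \<open>?w\<close> both \<open>\<alpha>\<close> and \<open>\<alpha> \<circ> T\<close> vanish,
      hence so does their difference \<open>\<alpha> \<circ> E\<close>.\<close>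
    let ?w = "\<lambda>R. w (R - {i})"
    have "0 = (\<Sum>R\<in>Pow {1..i}. adjoint_functional i \<alpha> R * ?w R)"
      using inv[where \<beta> = "adjoint_functional i \<alpha>" and w = w] anti_adj by simp
    also have "\<dots> = (\<Sum>S\<in>Pow {1..i}. \<alpha> S * ?w S) + (\<Sum>S\<in>Pow {1..i}. \<alpha> S * (\<Sum>s\<in>S. ?w (lowered s S)))"
      unfolding sum_adjoint_functional by (simp add: distrib_left sum.distrib)
    also have "(\<Sum>S\<in>Pow {1..i}. \<alpha> S * ?w S) = 0" using inv[where \<beta> = \<alpha> and w = w] anti\<alpha> by simp
    also have "(\<Sum>S\<in>Pow {1..i}. \<alpha> S * (\<Sum>s\<in>S. ?w (lowered s S)))
        = (\<Sum>S\<in>Pow {1..i}. \<alpha> S * (\<Sum>s\<in>S. w (lowered s S)))"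
    proof (intro sum.cong refl arg_cong2[of _ _ _ _ "(*)"])
      fix S s assume "S \<in> Pow {1..i}" "s \<in> S"
      then have "i \<notin> lowered s S" using lowered_subset[of S i s] by auto
      then have "lowered s S - {i} = lowered s S" by blast
      then show "?w (lowered s S) = w (lowered s S)" by presburger
    qed
    finally show "(\<Sum>S\<in>Pow {1..i}. \<alpha> S * (\<Sum>s\<in>S. w (lowered s S))) = 0" by simp
  qed fact
qed

text \<open>Induction on the dimension, with an inner induction that weakens spanning to arbitrary
  sets: if \<open>\<beta>\<close> vanishes on sets of dimension at least \<open>m + 1\<close>, its
  adjoint vanishes on those of dimension at least \<open>m\<close>, and injectivity of the adjoint
  leads back to \<open>\<beta>\<close>.\<close>

lemma functional_vanishing_on_spanning:
  fixes V :: "'a::euclidean_space set"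
  assumes "1 \<le> D" "subspace V" "dim V = D"
    and "\<And>A. finite A \<Longrightarrow> A \<subseteq> V \<Longrightarrow> span A = V \<Longrightarrow>
        (\<Sum>S\<in>Pow {1..<D}. \<alpha> S * real (card (flags A S))) = 0"
    and "S \<subseteq> {1..<D}"
  shows "\<alpha> S = 0"
  using assms
proof (induction D arbitrary: V \<alpha> S rule: dec_induct)
  case base
  \<comment> \<open>In dimension one the only rank set is empty and its flag number is
    \<open>1\<close>, so a single spanning set suffices.\<close>
  obtain B where "finite B" "B \<subseteq> V" "span B = V"
    by (rule basis_subspace_exists[OF base.prems(1)])
  then show ?case using base.prems(3)[of B] base.prems(4) by simp
next
  case (step i)
  have "i \<le> dim V" using step.prems(2) by simp
  then obtain W where "subspace W" "W \<subseteq> span V" "dim W = i"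
    by (rule choose_subspace_of_subspace)
  with step.prems(1) have W: "subspace W" "W \<subseteq> V" "dim W = i"
    using span_eq_iff[THEN iffD2, of V] by auto
  have Suci: "{1..<Suc i} = {1..i}" by auto
  have zero: "\<forall>S\<subseteq>{1..i}. \<beta> S = 0"
    if "m \<le> Suc i" "\<And>A. finite A \<Longrightarrow> A \<subseteq> V \<Longrightarrow> m \<le> dim A \<Longrightarrow> flag_functional i \<beta> A = 0" for m \<beta>
    using that
  proof (induction m arbitrary: \<beta>)
    case 0
    show ?case
    proof (intro allI impI)
      fix S assume S: "S \<subseteq> {1..i}"
      show "\<beta> S = 0"
      proof (rule functional_vanishing_on_all[OF step.prems(1,2) W step.hyps(1) _ _ S])
        show "\<gamma> R = 0" if "\<And>A. finite A \<Longrightarrow> A \<subseteq> W \<Longrightarrow> span A = W \<Longrightarrow>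
            (\<Sum>S\<in>Pow {1..<i}. \<gamma> S * real (card (flags A S))) = 0" "R \<subseteq> {1..<i}" for \<gamma> R
          using step.IH[OF W(1,3) that] .
        show "flag_functional i \<beta> A = 0" if "finite A" "A \<subseteq> V" for A
          using 0 that by blast
      qed
    qed
  next
    case (Suc m)
    have "\<forall>S\<subseteq>{1..i}. adjoint_functional i \<beta> S = 0"
    proof (rule Suc.IH)
      fix A assume A: "finite A" "A \<subseteq> V" "m \<le> dim A"
      obtain p where pV: "p \<in> V" and p: "generic_extension A p (Suc i)"
        by (rule exists_generic_extension[OF A(1) step.prems(1,2)])
      \<comment> \<open>\<open>span A\<close> is itself a flat, so \<open>p\<close> raises the
        dimension unless \<open>A\<close> already spans \<open>V\<close>.\<close>
      have "dim A < Suc i \<Longrightarrow> p \<notin> span A"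
        using generic_extension.generic[OF p span_in_flats] by simp
      then have "Suc m \<le> dim (insert p A)"
        using A(3) Suc.prems(1) by (cases "dim A < Suc i") (auto simp: dim_insert)
      then show "flag_functional i (adjoint_functional i \<beta>) A = 0"
        using Suc.prems(2)[of "insert p A"] A pV flag_functional_insert_generic[OF p, of \<beta>] by simp
    qed (use Suc.prems in simp)
    then show ?case using adjoint_functional_injective[of i \<beta>] by blast
  qed
  have "flag_functional i \<alpha> A = 0" if A: "finite A" "A \<subseteq> V" "Suc i \<le> dim A" for A
  proof -
    have "span A \<subseteq> V" using A(2) step.prems(1) by (simp add: span_minimal)
    then have "span A = V"
      using subspace_dim_equal[of "span A" V] step.prems A(3) by simp
    then show ?thesis using step.prems(3)[OF A(1,2)] unfolding Suci by blast
  qed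
  then have "\<forall>S\<subseteq>{1..i}. \<alpha> S = 0" using zero[OF order_refl] by blast
  then show ?case using step.prems(4) unfolding Suci by blast
qed

subsection \<open>Zonotopes\<close>

text \<open>An arbitrary index set and possibly zero generators are allowed, so that faces are
  translates of zonotopes of subfamilies of the same \<open>z\<close>.\<close>

definition zonotope_of :: "'i set \<Rightarrow> ('i \<Rightarrow> 'a::euclidean_space) \<Rightarrow> 'a set" where
  "zonotope_of I z = {(\<Sum>j\<in>I. c j *\<^sub>R z j) | c :: 'i \<Rightarrow> real. \<forall>j\<in>I. -1 \<le> c j \<and> c j \<le> 1}"

text \<open>A Minkowski sum of segments; convex hulls commute with such sums, which leaves the hull
  of a finite set.\<close>

lemma polytope_zonotope_of:
  fixes z :: "'i \<Rightarrow> 'a::euclidean_space"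
  assumes "finite I"
  shows "polytope (zonotope_of I z)"
proof -
  have seg: "convex hull {- v, v} = {r *\<^sub>R v | r. -1 \<le> r \<and> r \<le> 1}" for v :: 'a
  proof -
    have "convex hull {- v, v} = (\<lambda>u. (2 * u - 1) *\<^sub>R v) ` {0..1}"
    proof -
      have "(1 - u) *\<^sub>R (- v) + u *\<^sub>R v = (2 * u - 1) *\<^sub>R v" for u :: real
        by (simp add: scaleR_left_diff_distrib flip: scaleR_left_distrib mult_2)
      then show ?thesis
        by (auto simp: closed_segment_def simp flip: segment_convex_hull)
    qed
    also have "\<dots> = (\<lambda>r. r *\<^sub>R v) ` ((\<lambda>u. 2 * u - 1) ` {0..1})" by (simp add: image_image)
    also have "(\<lambda>u::real. 2 * u - 1) ` {0..1} = {-1..1}"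
      using image_affinity_atLeastAtMost[of 2 "-1" 0 "1::real"] by simp
    finally show ?thesis by auto
  qed
  have "zonotope_of I z = (\<Sum>j\<in>I. convex hull {- z j, z j})"
  proof
    show "zonotope_of I z \<subseteq> (\<Sum>j\<in>I. convex hull {- z j, z j})"
      unfolding zonotope_of_def set_sum_alt[OF assms] seg by blast
    show "(\<Sum>j\<in>I. convex hull {- z j, z j}) \<subseteq> zonotope_of I z"
    proof
      fix x assume "x \<in> (\<Sum>j\<in>I. convex hull {- z j, z j})"
      then obtain s where x: "x = sum s I"
        and s: "\<forall>j\<in>I. \<exists>r. s j = r *\<^sub>R z j \<and> -1 \<le> r \<and> r \<le> 1"
        unfolding set_sum_alt[OF assms] seg by blast
      from bchoice[OF s] obtain c where c: "\<forall>j\<in>I. s j = c j *\<^sub>R z j \<and> -1 \<le> c j \<and> c j \<le> 1" ..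
      then have "x = (\<Sum>j\<in>I. c j *\<^sub>R z j)" by (simp add: x)
      with c show "x \<in> zonotope_of I z" by (auto simp: zonotope_of_def)
    qed
  qed
  also have "\<dots> = convex hull (\<Sum>j\<in>I. {- z j, z j})" by (simp add: convex_hull_set_sum)
  finally show ?thesis
    using finite_set_sum[of I "\<lambda>j. {- z j, z j}"] by (auto simp: polytope_def)
qed

lemma span_zonotope_of:
  assumes "finite I"
  shows "span (zonotope_of I z) = span (z ` I)"
proof (rule antisym)
  show "span (zonotope_of I z) \<subseteq> span (z ` I)"
    by (rule span_minimal)
      (auto simp: zonotope_of_def intro!: span_sum span_scale intro: span_base)
  have "z j \<in> zonotope_of I z" if "j \<in> I" for j
  proof -
    have "(\<Sum>i\<in>I. (if i = j then 1 else 0) *\<^sub>R z i) = (\<Sum>i\<in>I. if i = j then z i else 0)"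
      by (intro sum.cong) auto
    then have "z j = (\<Sum>i\<in>I. (if i = j then 1 else 0) *\<^sub>R z i)"
      using that assms by simp
    then show ?thesis
      unfolding zonotope_of_def by (auto intro!: exI[of _ "\<lambda>i. if i = j then 1 else 0"])
  qed
  then show "span (z ` I) \<subseteq> span (zonotope_of I z)" by (intro span_mono) auto
qed

lemma affine_hull_zonotope_of:
  assumes "finite I"
  shows "affine hull (zonotope_of I z) = span (z ` I)"
proof -
  have "0 \<in> zonotope_of I z" by (auto simp: zonotope_of_def intro!: exI[of _ "\<lambda>_. 0"])
  then show ?thesis by (simp add: affine_hull_span_0 hull_inc span_zonotope_of[OF assms])
qed

lemma parallel_subspace_translate_zonotope_of:
  assumes "finite I"
  shows "parallel_subspace ((\<lambda>x. w + x) ` zonotope_of I z) = span (z ` I)"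
proof -
  let ?H = "affine hull ((\<lambda>x. w + x) ` zonotope_of I z)"
  have H: "?H = (\<lambda>x. w + x) ` span (z ` I)"
    by (simp add: affine_hull_translation affine_hull_zonotope_of[OF assms])
  have par: "subspace (span (z ` I)) \<and> affine_parallel ?H (span (z ` I))"
    unfolding H affine_parallel_def by (auto simp: image_image intro!: exI[of _ "- w"])
  have "?H \<noteq> {}" unfolding H using span_zero by blast
  then have "\<exists>!L. subspace L \<and> affine_parallel ?H L"
    by (rule affine_parallel_subspace[OF affine_affine_hull])
  then show ?thesis unfolding parallel_subspace_def using par by (rule the1_equality)
qed

text \<open>\<open>h\<close> is the support function. In direction \<open>a\<close>, each term
  \<open>c j * (a \<bullet> z j)\<close> is at most \<open>\<bar>a \<bullet> z j\<bar>\<close>;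
  equality fixes \<open>c j\<close> to the sign of \<open>a \<bullet> z j\<close>, except for
  generators orthogonal to \<open>a\<close>, whose coefficients stay free.\<close>

lemma supporting_face_zonotope_of:
  fixes z :: "'i \<Rightarrow> 'a::euclidean_space"
  assumes "finite I"
  defines "h \<equiv> \<lambda>a. \<Sum>j\<in>I. \<bar>a \<bullet> z j\<bar>"
  shows "x \<in> zonotope_of I z \<Longrightarrow> a \<bullet> x \<le> h a"
    and "zonotope_of I z \<inter> {x. a \<bullet> x = h a}
      = (\<lambda>x. (\<Sum>j\<in>I - {j \<in> I. a \<bullet> z j = 0}. sgn (a \<bullet> z j) *\<^sub>R z j) + x)
          ` zonotope_of {j \<in> I. a \<bullet> z j = 0} z"
proof -
  let ?J = "{j \<in> I. a \<bullet> z j = 0}"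
  let ?w = "\<Sum>j\<in>I - ?J. sgn (a \<bullet> z j) *\<^sub>R z j"
  have bound: "c * t \<le> \<bar>t\<bar>" if "-1 \<le> c" "c \<le> 1" for c t :: real
  proof -
    have "\<bar>c\<bar> \<le> 1" using that by auto
    then have "\<bar>c * t\<bar> \<le> \<bar>t\<bar>" using mult_right_mono[of "\<bar>c\<bar>" 1 "\<bar>t\<bar>"] by (simp add: abs_mult)
    then show ?thesis by linarith
  qed
  have inner: "a \<bullet> (\<Sum>j\<in>I. c j *\<^sub>R z j) = (\<Sum>j\<in>I. c j * (a \<bullet> z j))" for c
    by (simp add: inner_sum_right)
  show "x \<in> zonotope_of I z \<Longrightarrow> a \<bullet> x \<le> h a"
    unfolding h_def zonotope_of_def by (auto simp: inner intro!: sum_mono bound)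
  have split: "(\<Sum>j\<in>I. f j) = (\<Sum>j\<in>I - ?J. f j) + (\<Sum>j\<in>?J. f j)" for f :: "'i \<Rightarrow> 'a"
    using assms(1) by (intro sum.subset_diff) auto
  show "zonotope_of I z \<inter> {x. a \<bullet> x = h a} = (\<lambda>x. ?w + x) ` zonotope_of ?J z"
  proof
    show "zonotope_of I z \<inter> {x. a \<bullet> x = h a} \<subseteq> (\<lambda>x. ?w + x) ` zonotope_of ?J z"
    proof
      fix x assume x: "x \<in> zonotope_of I z \<inter> {x. a \<bullet> x = h a}"
      then obtain c where c: "\<forall>j\<in>I. -1 \<le> c j \<and> c j \<le> 1" and xc: "x = (\<Sum>j\<in>I. c j *\<^sub>R z j)"
        by (auto simp: zonotope_of_def)
      have "(\<Sum>j\<in>I. \<bar>a \<bullet> z j\<bar> - c j * (a \<bullet> z j)) = 0"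
        using x by (simp add: xc inner h_def sum_subtractf)
      then have eq: "\<forall>j\<in>I. \<bar>a \<bullet> z j\<bar> - c j * (a \<bullet> z j) = 0"
        using c bound assms(1) by (subst (asm) sum_nonneg_eq_0_iff) auto
      have "c j = sgn (a \<bullet> z j)" if "j \<in> I - ?J" for j
      proof -
        have nz: "a \<bullet> z j \<noteq> 0" using that by blast
        have "c j * (a \<bullet> z j) = \<bar>a \<bullet> z j\<bar>" using eq that by simp
        then have "c j * (a \<bullet> z j) = sgn (a \<bullet> z j) * (a \<bullet> z j)" by (simp add: abs_sgn mult.commute)
        with nz show ?thesis by simp
      qed
      then have "x = ?w + (\<Sum>j\<in>?J. c j *\<^sub>R z j)" unfolding xc split by simp
      moreover have "(\<Sum>j\<in>?J. c j *\<^sub>R z j) \<in> zonotope_of ?J z"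
        using c unfolding zonotope_of_def by blast
      ultimately show "x \<in> (\<lambda>x. ?w + x) ` zonotope_of ?J z" by blast
    qed
    show "(\<lambda>x. ?w + x) ` zonotope_of ?J z \<subseteq> zonotope_of I z \<inter> {x. a \<bullet> x = h a}"
    proof
      fix x assume "x \<in> (\<lambda>x. ?w + x) ` zonotope_of ?J z"
      then obtain c where c: "\<forall>j\<in>?J. -1 \<le> c j \<and> c j \<le> 1" and xc: "x = ?w + (\<Sum>j\<in>?J. c j *\<^sub>R z j)"
        by (auto simp: zonotope_of_def)
      define c' where "c' j = (if a \<bullet> z j = 0 then c j else sgn (a \<bullet> z j))" for j
      have x: "x = (\<Sum>j\<in>I. c' j *\<^sub>R z j)"
        unfolding split xc by (intro arg_cong2[of _ _ _ _ "(+)"] sum.cong) (auto simp: c'_def)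
      have "\<forall>j\<in>I. -1 \<le> c' j \<and> c' j \<le> 1" using c by (auto simp: c'_def sgn_if)
      then have "x \<in> zonotope_of I z" using x by (auto simp: zonotope_of_def)
      moreover have "a \<bullet> x = h a"
        unfolding x inner h_def by (intro sum.cong refl) (auto simp: c'_def sgn_if)
      ultimately show "x \<in> zonotope_of I z \<inter> {x. a \<bullet> x = h a}" by simp
    qed
  qed
qed

text \<open>\<open>a\<close> is chosen in the orthogonal complement of \<open>span B\<close>,
  outside the subspaces orthogonal to the vectors \<open>v\<close> of \<open>A\<close> not in
  \<open>span B\<close>. None of these contains the complement: the component \<open>q\<close> of
  \<open>v\<close> orthogonal to \<open>span B\<close> is nonzero and
  \<open>q \<bullet> v = q \<bullet> q\<close>.\<close>

lemma exists_functional_with_zeros: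
  fixes A :: "'a::euclidean_space set"
  assumes "finite A"
  obtains a where "\<And>v. v \<in> A \<Longrightarrow> a \<bullet> v = 0 \<longleftrightarrow> v \<in> span B"
proof -
  let ?V = "{a. \<forall>x\<in>span B. a \<bullet> x = 0}"
  have "\<exists>a\<in>?V. \<forall>T\<in>(\<lambda>v. {a. a \<bullet> v = 0}) ` (A - span B). a \<notin> T"
  proof (rule avoid_proper_subspaces)
    show "subspace ?V" by (auto simp: subspace_def inner_add_left)
    fix T assume "T \<in> (\<lambda>v. {a. a \<bullet> v = 0}) ` (A - span B)"
    then obtain v where v: "v \<notin> span B" and T: "T = {a. a \<bullet> v = 0}" by blast
    obtain y q where yq: "y \<in> span B" "\<And>w. w \<in> span B \<Longrightarrow> orthogonal q w" "v = y + q"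
      using orthogonal_subspace_decomp_exists[of B v] by blast
    have "q \<noteq> 0" using v yq by auto
    then have "q \<bullet> v \<noteq> 0" using yq by (simp add: inner_add_right orthogonal_def)
    then have "q \<in> ?V - T" using yq T by (simp add: orthogonal_def)
    moreover have "subspace T" unfolding T by (auto simp: subspace_def inner_add_left)
    ultimately show "subspace T \<and> \<not> ?V \<subseteq> T" by blast
  qed (use assms in simp)
  then obtain a where "\<forall>x\<in>span B. a \<bullet> x = 0" "\<forall>v\<in>A - span B. a \<bullet> v \<noteq> 0" by auto
  then show thesis using that[of a] by blast
qed

text \<open>Faces of a polytope are exposed, and the face in direction \<open>a\<close> is parallel
  to the span of the generators orthogonal to \<open>a\<close>. Conversely each flat is the span of
  the generators orthogonal to a suitable \<open>a\<close>.\<close>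

lemma lattice_of_flats_zonotope_of:
  fixes z :: "'i \<Rightarrow> 'a::euclidean_space"
  assumes "finite I"
  shows "lattice_of_flats (zonotope_of I z) = flats (z ` I)"
proof
  let ?Z = "zonotope_of I z"
  define h where "h a = (\<Sum>j\<in>I. \<bar>a \<bullet> z j\<bar>)" for a
  note supp = supporting_face_zonotope_of[OF assms, where z = z, folded h_def]
  have nonempty: "zonotope_of J z \<noteq> {}" for J
    by (auto simp: zonotope_of_def intro!: exI[of _ "\<lambda>_. 0"])
  have attained: "?Z \<inter> {x. a \<bullet> x = h a} \<noteq> {}" for a
    unfolding supp(2) using nonempty by simp
  have par: "parallel_subspace (?Z \<inter> {x. a \<bullet> x = h a}) = span (z ` {j \<in> I. a \<bullet> z j = 0})" for a
    unfolding supp(2) using assms by (intro parallel_subspace_translate_zonotope_of) simp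
  show "lattice_of_flats ?Z \<subseteq> flats (z ` I)"
  proof
    fix L assume "L \<in> lattice_of_flats ?Z"
    then obtain F where L: "L = parallel_subspace F" and F: "F face_of ?Z" "F \<noteq> {}"
      by (auto simp: lattice_of_flats_def)
    have "F exposed_face_of ?Z"
      using F exposed_face_of_polyhedron polytope_imp_polyhedron polytope_zonotope_of[OF assms] by blast
    then obtain a b where ab: "?Z \<subseteq> {x. a \<bullet> x \<le> b}" "F = ?Z \<inter> {x. a \<bullet> x = b}"
      by (auto simp: exposed_face_of_def)
    \<comment> \<open>A nonempty face forces its level to be the maximum of \<open>a\<close> over
      the zonotope, which is attained.\<close>
    have "b = h a"
    proof (rule antisym)
      show "b \<le> h a" using F(2) supp(1) ab(2) by blast
      show "h a \<le> b" using attained[of a] ab(1) by auto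
    qed
    then show "L \<in> flats (z ` I)" unfolding L ab(2) by (auto simp: par flats_def)
  qed
  show "flats (z ` I) \<subseteq> lattice_of_flats ?Z"
  proof
    fix L assume "L \<in> flats (z ` I)"
    then obtain B where B: "B \<subseteq> z ` I" "L = span B" by (auto simp: flats_def)
    obtain a where a: "\<And>v. v \<in> z ` I \<Longrightarrow> a \<bullet> v = 0 \<longleftrightarrow> v \<in> span B"
      using exists_functional_with_zeros[of "z ` I" B] assms by blast
    have "z ` {j \<in> I. a \<bullet> z j = 0} = z ` I \<inter> span B" using a by auto
    \<comment> \<open>The generators orthogonal to \<open>a\<close> may exceed \<open>B\<close>, but
      they have the same span.\<close>
    moreover have "span (z ` I \<inter> span B) = span B"
    proof (rule antisym)
      show "span (z ` I \<inter> span B) \<subseteq> span B" by (rule span_minimal) auto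
      show "span B \<subseteq> span (z ` I \<inter> span B)" using B(1) by (intro span_mono) (auto intro: span_base)
    qed
    ultimately have "L = parallel_subspace (?Z \<inter> {x. a \<bullet> x = h a})" using B(2) par by simp
    moreover have "(?Z \<inter> {x. a \<bullet> x = h a}) face_of ?Z"
      using polytope_imp_convex[OF polytope_zonotope_of[OF assms]] supp(1)
      by (rule face_of_Int_supporting_hyperplane_le)
    ultimately show "L \<in> lattice_of_flats ?Z"
      unfolding lattice_of_flats_def using attained by blast
  qed
qed

section \<open>Rank and flag numbers in the lattice of flats\<close>

lemma dim_strict_mono_flats:
  assumes "F \<in> flats A" "G \<in> flats A" "F \<subset> G"
  shows "dim F < dim G"
  using assms dim_psubset[of F G] by (simp add: span_flat)

text \<open>The members are the spans obtained by adding the elements of \<open>B\<close> one at a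
  time, starting from \<open>{0}\<close>.\<close>

lemma exists_maximal_flag_below:
  assumes "finite B" "independent B" "B \<subseteq> A"
  shows "\<exists>cs. sorted_wrt (<) cs \<and> set cs \<subseteq> {G \<in> flats A. G \<subseteq> span B} \<and> length cs = Suc (card B)"
  using assms
proof (induction B)
  case empty
  then show ?case using zero_in_flats[of A] by (intro exI[of _ "[{0}]"]) auto
next
  case (insert b B)
  have b: "b \<notin> span B" "independent B"
    using insert.prems(1) insert.hyps(2) by (auto simp: independent_insert)
  then obtain cs where cs: "sorted_wrt (<) cs" "set cs \<subseteq> {G \<in> flats A. G \<subseteq> span B}"
    "length cs = Suc (card B)" using insert by auto
  have psub: "span B \<subset> span (insert b B)"
    using b(1) span_mono[of B "insert b B"] span_base[of b "insert b B"] by blast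
  have "span (insert b B) \<in> flats A" using insert.prems by (auto simp: flats_def)
  then show ?case
    using cs psub insert.hyps
    by (intro exI[of _ "cs @ [span (insert b B)]"]) (auto simp: sorted_wrt_append)
qed

text \<open>Dimension strictly increases along a chain, which bounds its length; a basis of
  \<open>F\<close> taken from \<open>A\<close> gives a chain attaining the bound.\<close>

lemma poset_rank_flats:
  assumes "F \<in> flats A"
  shows "poset_rank (flats A) F = dim F"
  unfolding poset_rank_def
proof (rule Max_eqI)
  let ?N = "{n. \<exists>cs. sorted_wrt (<) cs \<and> set cs \<subseteq> {y \<in> flats A. y \<le> F} \<and> length cs = Suc n}"
  have le: "n \<le> dim F" if n: "n \<in> ?N" for n
  proof -
    obtain cs where cs: "sorted_wrt (<) cs" "set cs \<subseteq> {y \<in> flats A. y \<le> F}" "length cs = Suc n"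
      using n by blast
    have "sorted_wrt (\<lambda>x y. dim x < dim y) cs"
      by (rule sorted_wrt_mono_rel[OF _ cs(1)]) (use cs(2) dim_strict_mono_flats in blast)
    then have "sorted_wrt (<) (map dim cs)" by (simp add: sorted_wrt_map)
    then have "distinct (map dim cs)" unfolding strict_sorted_iff by blast
    then have "Suc n = card (dim ` set cs)" using cs(3) distinct_card by fastforce
    also have "\<dots> \<le> card {..dim F}"
      using cs(2) by (intro card_mono) (auto intro!: dim_subset)
    finally show ?thesis by simp
  qed
  then show "finite ?N" by (intro finite_subset[of ?N "{..dim F}"]) auto
  obtain C where C: "C \<subseteq> A" "F = span C" using assms by (auto simp: flats_def)
  obtain B where B: "B \<subseteq> C" "independent B" "C \<subseteq> span B" "card B = dim C"
    by (rule basis_exists)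
  have "span B = F" using B C span_mono[of B C] span_minimal[of C "span B"] by auto
  then show "dim F \<in> ?N"
    using exists_maximal_flag_below[of B A] B C independent_imp_finite[of B] by auto
  show "n \<le> dim F" if "n \<in> ?N" for n using le that .
qed

lemma sorted_wrt_total:
  assumes "sorted_wrt R xs" "x \<in> set xs" "y \<in> set xs"
  shows "x = y \<or> R x y \<or> R y x"
proof -
  obtain i j where "i < length xs" "x = xs ! i" "j < length xs" "y = xs ! j"
    using assms(2,3) by (auto simp: in_set_conv_nth)
  then show ?thesis
    using sorted_wrt_nth_less[OF assms(1), of i j] sorted_wrt_nth_less[OF assms(1), of j i]
    by (cases i j rule: linorder_cases) auto
qed

text \<open>A flag is listed along the sorted \<open>S\<close>. Conversely, rank is dimension and
  the members of a chain have distinct dimensions, so inverting \<open>dim\<close> on the chain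
  recovers the flag.\<close>

lemma flag_number_flats:
  assumes "finite S"
  shows "flag_number (flats A) S = card (flags A S)"
proof -
  let ?l = "sorted_list_of_set S"
  let ?X = "{cs. sorted_wrt (<) cs \<and> set cs \<subseteq> flats A \<and> map (poset_rank (flats A)) cs = ?l}"
  have "bij_betw (\<lambda>c. map c ?l) (flags A S) ?X"
    unfolding bij_betw_def
  proof
    show "inj_on (\<lambda>c. map c ?l) (flags A S)"
    proof
      fix c c' assume "c \<in> flags A S" "c' \<in> flags A S" "map c ?l = map c' ?l"
      then show "c = c'"
        using assms by (intro PiE_ext[of c S "\<lambda>_. flats A"]) (auto simp: flags_def)
    qed
    show "(\<lambda>c. map c ?l) ` flags A S = ?X"
    proof
      show "(\<lambda>c. map c ?l) ` flags A S \<subseteq> ?X"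
      proof
        fix cs assume "cs \<in> (\<lambda>c. map c ?l) ` flags A S"
        then obtain c where cs: "cs = map c ?l" and "c \<in> flags A S" by blast
        then have c: "\<And>t. t \<in> S \<Longrightarrow> c t \<in> flats A \<and> dim (c t) = t"
          "\<And>t u. t \<in> S \<Longrightarrow> u \<in> S \<Longrightarrow> t \<le> u \<Longrightarrow> c t \<subseteq> c u" by (auto simp: flags_def)
        have "c t < c u" if "t \<in> S" "u \<in> S" "t < u" for t u
        proof -
          have "c t \<noteq> c u" using c(1)[OF that(1)] c(1)[OF that(2)] that(3) by auto
          then show ?thesis using c(2)[OF that(1,2)] that(3) by auto
        qed
        then have "sorted_wrt (<) cs"
          unfolding cs sorted_wrt_map using assms
          by (intro sorted_wrt_mono_rel[OF _ strict_sorted_list_of_set]) auto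
        moreover have "map (poset_rank (flats A)) cs = ?l"
          unfolding cs map_map using c(1) assms by (intro map_idI) (simp add: poset_rank_flats)
        ultimately show "cs \<in> ?X" using c(1) assms by (auto simp: cs)
      qed
      show "?X \<subseteq> (\<lambda>c. map c ?l) ` flags A S"
      proof
        fix cs assume "cs \<in> ?X"
        then have cs: "sorted_wrt (<) cs" "set cs \<subseteq> flats A" "map (poset_rank (flats A)) cs = ?l"
          by auto
        have md: "map dim cs = ?l" unfolding cs(3)[symmetric]
          using cs(2) by (auto simp: poset_rank_flats)
        then have dS: "dim ` set cs = S" using assms by (metis list.set_map set_sorted_list_of_set)
        have inj: "inj_on dim (set cs)"
          using md distinct_map distinct_sorted_list_of_set by metis
        define c where "c = restrict (inv_into (set cs) dim) S"
        have cd: "c (dim F) = F" if "F \<in> set cs" for F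
          using that dS inj by (auto simp: c_def)
        have cS: "c t \<in> set cs \<and> dim (c t) = t" if "t \<in> S" for t
          using that dS cd by fastforce
        have "c t \<subseteq> c u" if tu: "t \<in> S" "u \<in> S" "t \<le> u" for t u
        proof -
          have "\<not> c u < c t"
            using dim_strict_mono_flats[of "c u" A "c t"] cS[OF tu(1)] cS[OF tu(2)] cs(2) tu(3) by auto
          then show ?thesis
            using sorted_wrt_total[OF cs(1), of "c t" "c u"] cS[OF tu(1)] cS[OF tu(2)] by auto
        qed
        then have "c \<in> flags A S"
          using cS cs(2) by (auto simp: flags_def c_def)
        moreover have "map c ?l = cs"
          unfolding md[symmetric] using cd by (simp add: map_idI)
        ultimately show "cs \<in> (\<lambda>c. map c ?l) ` flags A S" by blast
      qed
    qed
  qed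
  then show ?thesis unfolding flag_number_def by (simp add: bij_betw_same_card)
qed

lemma flag_number_empty: "flag_number Q {} = 1"
proof -
  have "{cs. sorted_wrt (<) cs \<and> set cs \<subseteq> Q \<and> map (poset_rank Q) cs = []} = {[]}" by auto
  then show ?thesis by (simp add: flag_number_def)
qed

text \<open>Zonotopes require nonzero generators; dropping \<open>0\<close> from \<open>A\<close>
  changes no span.\<close>

lemma zonotope_with_flats:
  fixes A :: "'a::euclidean_space set"
  assumes "finite A" "span A = UNIV"
  obtains Z where "zonotope Z" "aff_dim Z = int DIM('a)" "lattice_of_flats Z = flats A"
proof -
  have fin: "finite (A - {0})" using assms(1) by simp
  from ex_bij_betw_nat_finite_1[OF fin]
  obtain z where z: "bij_betw z {1..card (A - {0})} (A - {0})" by blast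
  define I where "I = {1..card (A - {0})}"
  have zI: "z ` I = A - {0}" using z by (simp add: bij_betw_def I_def)
  have flats: "flats (A - {0}) = flats A"
  proof
    show "flats (A - {0}) \<subseteq> flats A" by (rule flats_mono) blast
    show "flats A \<subseteq> flats (A - {0})"
    proof
      fix F assume "F \<in> flats A"
      then obtain B where "B \<subseteq> A" "F = span (B - {0})" by (auto simp: flats_def)
      then show "F \<in> flats (A - {0})" unfolding flats_def by blast
    qed
  qed
  show thesis
  proof
    have "z j \<noteq> 0" if "j \<in> I" for j using zI that by blast
    then show "zonotope (zonotope_of I z)"
      unfolding zonotope_def using polytope_zonotope_of[of I z]
      by (auto simp: zonotope_of_def I_def intro!: exI[of _ 0] exI[of _ "card (A - {0})"] exI[of _ z])
    have "affine hull zonotope_of I z = UNIV"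
      using affine_hull_zonotope_of[of I z] assms(2) zI by (simp add: I_def)
    then show "aff_dim (zonotope_of I z) = int DIM('a)"
      by (metis aff_dim_affine_hull aff_dim_UNIV)
    show "lattice_of_flats (zonotope_of I z) = flats A"
      using lattice_of_flats_zonotope_of[of I z] zI flats by (simp add: I_def)
  qed
qed

section \<open>The affine dimension of the set of flag-vectors\<close>

lemma bij_betw_Rep_rank_set:
  "bij_betw (Rep_rank_set :: 'n rank_set \<Rightarrow> nat set) UNIV (Pow {1..<CARD('n)})"
  using type_definition.Rep_range[OF type_definition_rank_set]
  by (auto simp: bij_betw_def inj_on_def Rep_rank_set_inject)

theorem theorem6p1:
  fixes d :: nat
  assumes "CARD('n::finite) = d + 1"
  shows "aff_dim {flag_vector (lattice_of_flats Z) :: real ^ 'n rank_set | Z :: (real ^ 'n) set.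
           zonotope Z \<and> aff_dim Z = int (d + 1)} = 2 ^ d - 1"
proof -
  let ?X = "{flag_vector (lattice_of_flats Z) :: real ^ 'n rank_set | Z :: (real ^ 'n) set.
           zonotope Z \<and> aff_dim Z = int (d + 1)}"
  let ?D = "CARD('n)"
  have "card (UNIV :: 'n rank_set set) = card (Pow {1..<?D})"
    using bij_betw_same_card[OF bij_betw_Rep_rank_set] .
  then have DIM: "DIM(real ^ 'n rank_set) = 2 ^ d"
    using assms by (simp add: card_Pow)
  have "dim ?X = 2 ^ d"
  proof (rule ccontr)
    assume "dim ?X \<noteq> 2 ^ d"
    then have "dim ?X < DIM(real ^ 'n rank_set)"
      using dim_subset_UNIV[of ?X] DIM by simp
    then obtain a :: "real ^ 'n rank_set" where a: "a \<noteq> 0" "span ?X \<subseteq> {x. a \<bullet> x = 0}"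
      using lowdim_subset_hyperplane by blast
    \<comment> \<open>The coordinates of \<open>a\<close>, indexed by the sets themselves; only
      subsets of \<open>{1..<CARD('n)}\<close> give meaningful values.\<close>
    define \<alpha> where "\<alpha> S = a $ Abs_rank_set S" for S
    have zero: "\<alpha> S = 0" if "S \<subseteq> {1..<?D}" for S
    proof (rule functional_vanishing_on_spanning[OF _ _ _ _ that])
      show "1 \<le> ?D" using assms by simp
      show "subspace (UNIV :: (real ^ 'n) set)" by simp
      show "dim (UNIV :: (real ^ 'n) set) = ?D" by simp
      fix A :: "(real ^ 'n) set"
      assume "finite A" "span A = UNIV"
      then obtain Z where Z: "zonotope Z" "aff_dim Z = int DIM(real ^ 'n)" "lattice_of_flats Z = flats A"
        by (rule zonotope_with_flats)
      then have "zonotope Z \<and> aff_dim Z = int (d + 1)" using assms by simp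
      then have "flag_vector (flats A) \<in> ?X" unfolding Z(3)[symmetric] by blast
      then have "flag_vector (flats A) \<in> {x. a \<bullet> x = 0}" by (rule subsetD[OF a(2) span_base])
      then have "0 = a \<bullet> flag_vector (flats A)" by simp
      also have "\<dots> = (\<Sum>T\<in>(UNIV :: 'n rank_set set). \<alpha> (Rep_rank_set T) * real (flag_number (flats A) (Rep_rank_set T)))"
        by (simp add: inner_vec_def flag_vector_def \<alpha>_def Rep_rank_set_inverse)
      also have "\<dots> = (\<Sum>S\<in>Pow {1..<?D}. \<alpha> S * real (flag_number (flats A) S))"
        by (rule sum.reindex_bij_betw[OF bij_betw_Rep_rank_set])
      also have "\<dots> = (\<Sum>S\<in>Pow {1..<?D}. \<alpha> S * real (card (flags A S)))"
        by (intro sum.cong refl) (auto simp: flag_number_flats finite_subset)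
      finally show "(\<Sum>S\<in>Pow {1..<?D}. \<alpha> S * real (card (flags A S))) = 0" by simp
    qed
    have "a = 0"
    proof (rule vec_eq_iff[THEN iffD2], rule allI)
      fix T show "a $ T = 0 $ T"
        using zero[of "Rep_rank_set T"] Rep_rank_set[of T] by (simp add: \<alpha>_def Rep_rank_set_inverse)
    qed
    with a(1) show False by simp
  qed
  moreover have "0 \<notin> affine hull ?X"
  proof -
    \<comment> \<open>The coordinate at the empty rank set is \<open>1\<close> on every flag-vector,
      which keeps the affine hull away from the origin.\<close>
    let ?e = "axis (Abs_rank_set {}) 1 :: real ^ 'n rank_set"
    have "?X \<subseteq> {x. ?e \<bullet> x = 1}"
      by (auto simp: inner_axis' flag_vector_def Abs_rank_set_inverse flag_number_empty)
    then have "affine hull ?X \<subseteq> {x. ?e \<bullet> x = 1}"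
      by (intro hull_minimal affine_hyperplane)
    then show ?thesis by auto
  qed
  \<comment> \<open>Adjoining the origin raises the affine dimension by one and makes it the linear
    dimension, whence \<open>2 ^ d - 1\<close>.\<close>
  moreover have "aff_dim (insert 0 ?X) = int (dim ?X)"
    by (subst aff_dim_zero) (auto simp: dim_insert span_zero intro: hull_inc)
  ultimately show ?thesis by (simp add: aff_dim_insert)
qed

end
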